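(* Let $\widetilde{G}$ be a connected $U(\mathbb{Q})$-gain graph of order $n$ with $p(\widetilde{G})=0$ and $c(\widetilde{G})\geq 3$. Then $r(\widetilde{G})=n-2c(\widetilde{G})+1$ if and only if $\widetilde{G}$ is obtained from a $U(\mathbb{Q})$-gain tree $\widetilde{T}$ with $p(\widetilde{T})=c(\widetilde{G})$ and $r(\widetilde{T})=|V(\widetilde{T})|-p(\widetilde{T})+1$ by attaching a $U(\mathbb{Q})$-gain cycle of Type 1 on each leaf of $\widetilde{T}$.
   Context: All graphs are finite and simple (no loops or multiple edges). $\mathbb{Q}$ denotes the real quaternions (not the rationals), and $U(\mathbb{Q})=\{q\in\mathbb{Q}:|q|=1\}$. A $U(\mathbb{Q})$-gain graph $\widetilde{G}=(G,U(\mathbb{Q}),\varphi)$ consists of a simple graph $G$ with vertices $v_1,\dots,v_n$ (the underlying graph) and a map $\varphi$ assigning to each ordered pair $(v_i,v_j)$ of adjacent vertices a unit quaternion $\varphi_{v_iv_j}$ with $\varphi_{v_iv_j}=\varphi_{v_jv_i}^{-1}=\overline{\varphi_{v_jv_i}}$. Its adjacency matrix $A(\widetilde{G})=(h_{ij})$ is the $n\times n$ Hermitian quaternion matrix with $h_{ij}=\varphi_{v_iv_j}$ if $v_i,v_j$ are adjacent and $h_{ij}=0$ otherwise. The rank $r(\widetilde{G})$ is the row left rank of $A(\widetilde{G})$, i.e. the maximum number of rows that are left linearly independent over $\mathbb{Q}$. $p(\widetilde{G})$ is the number of pendant vertices or leaves (vertices of degree 1), and $c(\widetilde{G})=|E(\widetilde{G})|-|V(\widetilde{G})|+\omega(\widetilde{G})$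 is the cyclomatic number, where $\omega(\widetilde{G})$ is the number of connected components. A $U(\mathbb{Q})$-gain tree (cycle) is a $U(\mathbb{Q})$-gain graph whose underlying graph is a tree (cycle). A $U(\mathbb{Q})$-gain cycle with vertices $u_1,\dots,u_m$ in cyclic order ($m\ge 3$) is of Type 1 if $m$ is even and $\varphi_{u_1u_2}\varphi_{u_2u_3}\cdots\varphi_{u_{m-1}u_m}\varphi_{u_mu_1}=(-1)^{m/2}$ (this does not depend on the starting vertex or direction). Attaching a cycle on a leaf $x$ of a tree means identifying one vertex of the cycle (disjoint from everything else) with $x$, keeping all gains; exactly one cycle is attached on each leaf. *)

theory Defs
  imports Complex_Main "Graph_Theory.Graph_Theory"
begin

section \<open>The real quaternions\<close>

datatype quat = Quat (qre: real) (qi: real) (qj: real) (qk: real)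

lemma quat_eq_iff: "p = q \<longleftrightarrow> qre p = qre q \<and> qi p = qi q \<and> qj p = qj q \<and> qk p = qk q"
  by (cases p; cases q) simp

instantiation quat :: ring_1
begin

definition "0 = Quat 0 0 0 0"
definition "1 = Quat 1 0 0 0"
definition "p + q = Quat (qre p + qre q) (qi p + qi q) (qj p + qj q) (qk p + qk q)"
definition "p - q = Quat (qre p - qre q) (qi p - qi q) (qj p - qj q) (qk p - qk q)"
definition "- q = Quat (- qre q) (- qi q) (- qj q) (- qk q)"
definition "p * q = Quat
  (qre p * qre q - qi p * qi q - qj p * qj q - qk p * qk q)
  (qre p * qi q + qi p * qre q + qj p * qk q - qk p * qj q)
  (qre p * qj q - qi p * qk q + qj p * qre q + qk p * qi q)
  (qre p * qk q + qi p * qj q - qj p * qi q + qk p * qre q)"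

lemmas quat_defs = zero_quat_def one_quat_def plus_quat_def minus_quat_def uminus_quat_def
  times_quat_def

instance
  by standard (simp_all add: quat_eq_iff quat_defs algebra_simps)

end

definition qcnj :: "quat \<Rightarrow> quat" where
  "qcnj q = Quat (qre q) (- qi q) (- qj q) (- qk q)"

definition qnorm :: "quat \<Rightarrow> real" where
  "qnorm q = sqrt ((qre q)\<^sup>2 + (qi q)\<^sup>2 + (qj q)\<^sup>2 + (qk q)\<^sup>2)"

instantiation quat :: division_ring
begin

definition "inverse q =
  (let n = (qre q)\<^sup>2 + (qi q)\<^sup>2 + (qj q)\<^sup>2 + (qk q)\<^sup>2
   in Quat (qre q / n) (- qi q / n) (- qj q / n) (- qk q / n))"
definition "(p :: quat) div q = p * inverse q"

instance
proof
  fix q :: quat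
  assume "q \<noteq> 0"
  define n where "n = (qre q)\<^sup>2 + (qi q)\<^sup>2 + (qj q)\<^sup>2 + (qk q)\<^sup>2"
  have "n \<noteq> 0"
    using \<open>q \<noteq> 0\<close> unfolding n_def
    by (auto simp: quat_eq_iff zero_quat_def add_nonneg_eq_0_iff)
  then have *: "qre q * qre q / n + qi q * qi q / n + qj q * qj q / n + qk q * qk q / n = 1"
    by (simp add: n_def power2_eq_square flip: add_divide_distrib)
  have inv: "inverse q = Quat (qre q / n) (- qi q / n) (- qj q / n) (- qk q / n)"
    by (simp add: inverse_quat_def n_def Let_def)
  show "inverse q * q = 1" "q * inverse q = 1"
    using * by (simp_all add: inv quat_eq_iff one_quat_def times_quat_def mult.commute)
qed (simp_all add: divide_quat_def quat_eq_iff inverse_quat_def zero_quat_def)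

end

lemma inverse_unit_quat:
  assumes "qnorm q = 1"
  shows "inverse q = qcnj q"
proof -
  have "(qre q)\<^sup>2 + (qi q)\<^sup>2 + (qj q)\<^sup>2 + (qk q)\<^sup>2 = 1"
    using assms by (simp add: qnorm_def)
  then show ?thesis by (simp add: inverse_quat_def qcnj_def)
qed


section \<open>Simple graphs\<close>

text \<open>
  A finite simple graph is a symmetric loop-free pair digraph (\<open>pair_graph\<close>), where the edge
  \<open>uv\<close> stands for the two arcs \<open>(u, v)\<close> and \<open>(v, u)\<close>. The library's \<open>tree\<close> and \<open>cycle\<close>
  are directed notions, for which an edge is already a cycle of length 2; hence cycles of
  length at least 3 are introduced here.
\<close>

definition edges :: "'a pair_pre_digraph \<Rightarrow> 'a set set" where
  "edges G = {{u, v} | u v. (u, v) \<in> parcs G}"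

definition pendants :: "'a pair_pre_digraph \<Rightarrow> 'a set" where
  "pendants G = {v \<in> pverts G. out_degree (with_proj G) v = 1}"

definition cyclomatic :: "'a pair_pre_digraph \<Rightarrow> int" where
  "cyclomatic G = int (card (edges G)) - int (card (pverts G))
     + int (card (pre_digraph.sccs (with_proj G)))"

text \<open>The pairs \<open>(u\<^sub>1,u\<^sub>2), \<dots>, (u\<^sub>m\<^sub>-\<^sub>1,u\<^sub>m), (u\<^sub>m,u\<^sub>1)\<close>.\<close>

definition cyc_pairs :: "'a list \<Rightarrow> ('a \<times> 'a) list" where
  "cyc_pairs us = zip us (rotate1 us)"

definition cycle_in :: "'a pair_pre_digraph \<Rightarrow> 'a list \<Rightarrow> bool" where
  "cycle_in G us \<longleftrightarrow> 3 \<le> length us \<and> distinct us \<and> set (cyc_pairs us) \<subseteq> parcs G"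

definition is_tree :: "'a pair_pre_digraph \<Rightarrow> bool" where
  "is_tree G \<longleftrightarrow> pair_graph G \<and> Digraph_Component.connected (with_proj G)
     \<and> (\<nexists>us. cycle_in G us)"

text \<open>\<open>G\<close> is the cycle graph with vertices \<open>us\<close>, listed in cyclic order.\<close>

definition is_cycle :: "'a pair_pre_digraph \<Rightarrow> 'a list \<Rightarrow> bool" where
  "is_cycle G us \<longleftrightarrow> 3 \<le> length us \<and> distinct us \<and> pverts G = set us
     \<and> parcs G = set (cyc_pairs us) \<union> (set (cyc_pairs us))\<inverse>"


section \<open>Quaternion unit gain graphs\<close>

text \<open>The values of \<open>\<phi>\<close> on nonadjacent pairs are irrelevant.\<close>

locale gain_graph = pair_graph G for G :: "'a pair_pre_digraph" +
  fixes \<phi> :: "'a \<Rightarrow> 'a \<Rightarrow> quat"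
  assumes gain_unit: "(u, v) \<in> parcs G \<Longrightarrow> qnorm (\<phi> u v) = 1"
    and gain_inverse: "(u, v) \<in> parcs G \<Longrightarrow> \<phi> u v = inverse (\<phi> v u)"

lemma (in gain_graph) gain_qcnj: "(u, v) \<in> parcs G \<Longrightarrow> \<phi> u v = qcnj (\<phi> v u)"
  using arcs_symmetric gain_inverse gain_unit inverse_unit_quat by metis

definition adj_matrix :: "'a pair_pre_digraph \<Rightarrow> ('a \<Rightarrow> 'a \<Rightarrow> quat) \<Rightarrow> 'a \<Rightarrow> 'a \<Rightarrow> quat" where
  "adj_matrix G \<phi> u v = (if (u, v) \<in> parcs G then \<phi> u v else 0)"

text \<open>
  Rows and columns of the matrix \<open>A\<close> are indexed by the finite set \<open>V\<close>. Independence is that of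
  the family of rows with index in \<open>S\<close>, so two equal rows with different indices are dependent.
\<close>

definition left_indep_rows :: "'a set \<Rightarrow> ('a \<Rightarrow> 'a \<Rightarrow> quat) \<Rightarrow> 'a set \<Rightarrow> bool" where
  "left_indep_rows V A S \<longleftrightarrow>
     (\<forall>c. (\<forall>j\<in>V. (\<Sum>i\<in>S. c i * A i j) = 0) \<longrightarrow> (\<forall>i\<in>S. c i = 0))"

definition row_left_rank :: "'a set \<Rightarrow> ('a \<Rightarrow> 'a \<Rightarrow> quat) \<Rightarrow> nat" where
  "row_left_rank V A = Max {card S | S. S \<subseteq> V \<and> left_indep_rows V A S}"

definition gain_rank :: "'a pair_pre_digraph \<Rightarrow> ('a \<Rightarrow> 'a \<Rightarrow> quat) \<Rightarrow> nat" where
  "gain_rank G \<phi> = row_left_rank (pverts G) (adj_matrix G \<phi>)"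

definition gain_tree :: "'a pair_pre_digraph \<Rightarrow> ('a \<Rightarrow> 'a \<Rightarrow> quat) \<Rightarrow> bool" where
  "gain_tree T \<phi> \<longleftrightarrow> gain_graph T \<phi> \<and> is_tree T"

text \<open>The condition on the gain product does not depend on the chosen cyclic listing \<open>us\<close>.\<close>

definition type1_cycle :: "'a pair_pre_digraph \<Rightarrow> ('a \<Rightarrow> 'a \<Rightarrow> quat) \<Rightarrow> bool" where
  "type1_cycle C \<phi> \<longleftrightarrow> gain_graph C \<phi> \<and>
     (\<exists>us. is_cycle C us \<and> even (length us) \<and>
       prod_list (map (\<lambda>(u, v). \<phi> u v) (cyc_pairs us)) = (- 1) ^ (length us div 2))"

text \<open>
  \<open>(G, \<phi>)\<close> arises from \<open>(T, \<psi>)\<close> by attaching a Type 1 cycle \<open>(C x, \<gamma> x)\<close> on each pendant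
  vertex \<open>x\<close> of \<open>T\<close>. The identification is made by giving the identified vertices the same
  name \<open>x\<close>: the cycle \<open>C x\<close> meets \<open>T\<close> exactly in \<open>x\<close>, and distinct cycles are disjoint.
\<close>

definition attach_type1_cycles ::
  "'a pair_pre_digraph \<Rightarrow> ('a \<Rightarrow> 'a \<Rightarrow> quat) \<Rightarrow> 'a pair_pre_digraph \<Rightarrow> ('a \<Rightarrow> 'a \<Rightarrow> quat) \<Rightarrow> bool"
where
  "attach_type1_cycles T \<psi> G \<phi> \<longleftrightarrow> (\<exists>C \<gamma>.
     (\<forall>x\<in>pendants T. type1_cycle (C x) (\<gamma> x) \<and> pverts (C x) \<inter> pverts T = {x}) \<and>
     (\<forall>x\<in>pendants T. \<forall>y\<in>pendants T. x \<noteq> y \<longrightarrow> pverts (C x) \<inter> pverts (C y) = {}) \<and>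
     pverts G = pverts T \<union> (\<Union>x\<in>pendants T. pverts (C x)) \<and>
     parcs G = parcs T \<union> (\<Union>x\<in>pendants T. parcs (C x)) \<and>
     (\<forall>(u, v)\<in>parcs T. \<phi> u v = \<psi> u v) \<and>
     (\<forall>x\<in>pendants T. \<forall>(u, v)\<in>parcs (C x). \<phi> u v = \<gamma> x u v))"

end

theory Submission
  imports Defs
begin

text \<open>
  Call a set \<open>S\<close> of vertices determining if a null vector of the adjacency matrix vanishing on \<open>S\<close> is zero;
  the nullity \<open>\<eta>\<close> is the least size of a determining set, so all estimates on \<open>\<eta>\<close> are combinatorial
  and no linear algebra over the quaternions is required.

  Deleting a vertex \<open>x\<close> gives \<open>\<eta>(G) \<le> 1 + \<Sum>\<eta>(C)\<close> over the components \<open>C\<close> of \<open>G - x\<close>, without the summand 1 and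
  without the component \<open>{y}\<close> if \<open>x\<close> is the neighbour of a leaf \<open>y\<close>; moreover
  \<open>c(G) = \<Sum>(c(C) + d\<^sub>C - 1)\<close>, where \<open>d\<^sub>C\<close> is the number of edges between \<open>x\<close> and \<open>C\<close>. Induction yields
  \<open>\<eta>(G) \<le> 2c(G) + p(G) - 1\<close> for every connected graph with at least two vertices that is not a Type 1 cycle: delete
  the neighbour of a leaf, or, if there is no leaf, a vertex on a cycle next to one of degree at least 3.

  Tracing equality through the induction shows that a tight graph with \<open>c \<ge> 1\<close> and \<open>p \<ge> 1\<close>, or with \<open>c \<ge> 3\<close> and
  \<open>p = 0\<close>, contains a Type 1 cycle attached at a single vertex, which has degree 3. Removing such a cycle
  up to its attaching vertex lowers \<open>\<eta>\<close> and \<open>c\<close> by one, creates one leaf, and preserves tightness, so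
  iterating leads to a tree.
\<close>

subsection \<open>Nullity as the least size of a determining set\<close>

text \<open>In terms of \<eta> = n - r the claim for a leafless graph reads \<eta> = 2c - 1, and the
  rank condition on the tree reads \<eta>(T) = p(T) - 1. Both are equality in the same bound, which
  is why that bound counts leaves. Its exceptions are a single vertex (\<eta> = 1, bound -1) and a
  Type 1 cycle (\<eta> = 2, bound 1), and both can appear as components after a deletion. Each
  component therefore has to be bounded by its share of 2c(G) + p(G): a single vertex is paid for by
  being a leaf of G, a Type 1 cycle by 2c(C) = 2, and the new leaves of any other component by the
  edges joining it to x. If G has no leaf, the vertex w of degree at least 3 next to x does not
  become a leaf; this gives a surplus of 2, which covers the summand 1 for x and yields the -1. Only
  induced subgraphs occur, so a subgraph is a set \<open>W\<close> of vertices inside one fixed arc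
  relation \<open>E\<close>, and components and deletions are set operations.\<close>

locale gained =
  fixes E :: "'a rel" and \<phi> :: "'a \<Rightarrow> 'a \<Rightarrow> quat"
  assumes E_sym: "(u, v) \<in> E \<Longrightarrow> (v, u) \<in> E"
    and E_irrefl: "(u, u) \<notin> E"
    and gain_mult: "(u, v) \<in> E \<Longrightarrow> \<phi> u v * \<phi> v u = 1"
begin

definition nb :: "'a set \<Rightarrow> 'a \<Rightarrow> 'a set" where
  "nb W v = {u \<in> W. (u, v) \<in> E}"

text \<open>The solutions of z A = 0 for the adjacency matrix A of the subgraph induced by
  \<open>W\<close>, with coefficients on the left as in \<open>left_indep_rows\<close>; values of
  \<open>z\<close> outside \<open>W\<close> do not enter.\<close>

definition null_vec :: "'a set \<Rightarrow> ('a \<Rightarrow> quat) \<Rightarrow> bool" where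
  "null_vec W z \<longleftrightarrow> (\<forall>j\<in>W. (\<Sum>i\<in>nb W j. z i * \<phi> i j) = 0)"

definition determ :: "'a set \<Rightarrow> 'a set \<Rightarrow> bool" where
  "determ W S \<longleftrightarrow> S \<subseteq> W \<and> (\<forall>z. null_vec W z \<longrightarrow> (\<forall>i\<in>S. z i = 0) \<longrightarrow> (\<forall>i\<in>W. z i = 0))"

definition nullity :: "'a set \<Rightarrow> nat" where
  "nullity W = (LEAST k. \<exists>S. determ W S \<and> card S = k)"

lemma nb_subset: "nb W v \<subseteq> W"
  by (auto simp: nb_def)

lemma finite_nb: "finite W \<Longrightarrow> finite (nb W v)"
  by (auto simp: nb_def)

lemma in_nb_iff: "u \<in> nb W v \<longleftrightarrow> u \<in> W \<and> (u, v) \<in> E"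
  by (simp add: nb_def)

lemma nb_Un: "nb (A \<union> B) v = nb A v \<union> nb B v"
  by (auto simp: nb_def)

lemma gain_nonzero: "(u, v) \<in> E \<Longrightarrow> \<phi> u v \<noteq> 0"
  using gain_mult[of u v] by auto

lemma determ_self: "determ W W"
  by (auto simp: determ_def)

lemma nullity_le: "determ W S \<Longrightarrow> nullity W \<le> card S"
  unfolding nullity_def by (rule Least_le) blast

lemma nullity_witness: obtains S where "determ W S" "card S = nullity W"
proof -
  have "\<exists>k S. determ W S \<and> card S = k"
    using determ_self by blast
  from LeastI_ex[OF this] show ?thesis
    using that unfolding nullity_def by blast
qed

lemma nullity_le_card: "nullity W \<le> card W"
  using nullity_le[OF determ_self] .

text \<open>A linear relation between the rows in \<open>S\<close>, extended by zero, is the same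
  thing as a null vector that vanishes on \<open>W - S\<close>.\<close>

lemma left_indep_rows_iff_determ:
  assumes "finite W" "S \<subseteq> W"
    and A: "\<And>u v. u \<in> W \<Longrightarrow> v \<in> W \<Longrightarrow> A u v = (if (u, v) \<in> E then \<phi> u v else 0)"
  shows "left_indep_rows W A S \<longleftrightarrow> determ W (W - S)"
proof -
  have sum_eq: "(\<Sum>i\<in>W. z i * A i j) = (\<Sum>i\<in>nb W j. z i * \<phi> i j)" if "j \<in> W" for z j
    using assms(1) that A
    by (intro sum.mono_neutral_cong_right) (auto simp: nb_def)
  have ext: "(\<Sum>i\<in>S. c i * A i j) = (\<Sum>i\<in>W. z i * A i j)"
    if "\<And>i. i \<in> S \<Longrightarrow> z i = c i" "\<And>i. i \<in> W - S \<Longrightarrow> z i = 0" for c z j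
    using assms(1,2) that by (intro sum.mono_neutral_cong_left) auto
  show ?thesis
  proof
    assume L: "left_indep_rows W A S"
    show "determ W (W - S)"
      unfolding determ_def
    proof (intro conjI allI impI ballI)
      fix z i assume z: "null_vec W z" "\<forall>i\<in>W - S. z i = 0" and "i \<in> W"
      have "\<forall>j\<in>W. (\<Sum>i\<in>S. z i * A i j) = 0"
        using z ext[of z z] sum_eq by (auto simp: null_vec_def)
      with L have "\<forall>i\<in>S. z i = 0"
        unfolding left_indep_rows_def by blast
      then show "z i = 0"
        using z \<open>i \<in> W\<close> by blast
    qed auto
  next
    assume D: "determ W (W - S)"
    show "left_indep_rows W A S"
      unfolding left_indep_rows_def
    proof (intro allI impI)
      fix c assume c: "\<forall>j\<in>W. (\<Sum>i\<in>S. c i * A i j) = 0"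
      define z where "z i = (if i \<in> S then c i else 0)" for i
      have "null_vec W z"
        using c ext[of z c] sum_eq by (auto simp: null_vec_def z_def)
      moreover have "\<forall>i\<in>W - S. z i = 0"
        by (simp add: z_def)
      ultimately have "\<forall>i\<in>W. z i = 0"
        using D unfolding determ_def by blast
      then show "\<forall>i\<in>S. c i = 0"
        using assms(2) by (metis subsetD z_def)
    qed
  qed
qed

text \<open>Complementation exchanges independent sets of rows and determining sets, hence the
  maximum of the former and the minimum of the latter.\<close>

lemma row_left_rank_eq:
  assumes "finite W"
    and A: "\<And>u v. u \<in> W \<Longrightarrow> v \<in> W \<Longrightarrow> A u v = (if (u, v) \<in> E then \<phi> u v else 0)"
  shows "row_left_rank W A = card W - nullity W"
proof -
  note iff = left_indep_rows_iff_determ[OF assms(1) _ A]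
  obtain S where S: "determ W S" "card S = nullity W"
    using nullity_witness by blast
  have "S \<subseteq> W"
    using S by (simp add: determ_def)
  show ?thesis
    unfolding row_left_rank_def
  proof (rule Max_eqI)
    have "{card S |S. S \<subseteq> W \<and> left_indep_rows W A S} \<subseteq> card ` Pow W"
      by auto
    then show "finite {card S |S. S \<subseteq> W \<and> left_indep_rows W A S}"
      using assms(1) finite_subset by fastforce
  next
    fix k assume "k \<in> {card S |S. S \<subseteq> W \<and> left_indep_rows W A S}"
    then obtain R where R: "R \<subseteq> W" "left_indep_rows W A R" "k = card R"
      by blast
    have "nullity W \<le> card (W - R)"
      using R iff[of R] nullity_le by blast
    then show "k \<le> card W - nullity W"
      using R assms(1) by (simp add: card_Diff_subset finite_subset card_mono)
         (metis R(1) card_mono diff_diff_cancel diff_le_mono2)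
  next
    have "left_indep_rows W A (W - S)"
      using iff[of "W - S"] S \<open>S \<subseteq> W\<close> by (simp add: double_diff)
    moreover have "card W - nullity W = card (W - S)"
      using S \<open>S \<subseteq> W\<close> assms(1) by (simp add: card_Diff_subset finite_subset)
    ultimately show "card W - nullity W \<in> {card S |S. S \<subseteq> W \<and> left_indep_rows W A S}"
      by blast
  qed
qed

subsection \<open>Components and vertex deletion\<close>

text \<open>These sets are the unions of components. Defining connectedness and components through
  them avoids walks altogether.\<close>

definition adj_closed :: "'a set \<Rightarrow> 'a set \<Rightarrow> bool" where
  "adj_closed W A \<longleftrightarrow> A \<subseteq> W \<and> (\<forall>u\<in>A. \<forall>v\<in>W. (u, v) \<in> E \<longrightarrow> v \<in> A)"

definition conn :: "'a set \<Rightarrow> bool" where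
  "conn W \<longleftrightarrow> W \<noteq> {} \<and> (\<forall>A. adj_closed W A \<longrightarrow> A \<noteq> {} \<longrightarrow> A = W)"

definition comps :: "'a set \<Rightarrow> 'a set set" where
  "comps W = {C. adj_closed W C \<and> conn C}"

definition eds :: "'a set \<Rightarrow> 'a set set" where
  "eds W = {{u, v} | u v. (u, v) \<in> E \<and> u \<in> W \<and> v \<in> W}"

text \<open>The number of components is fixed to 1, so this is the cyclomatic number only when
  \<open>W\<close> is connected.\<close>

definition cyc_num :: "'a set \<Rightarrow> int" where
  "cyc_num W = int (card (eds W)) - int (card W) + 1"

definition pend :: "'a set \<Rightarrow> 'a set" where
  "pend W = {v \<in> W. card (nb W v) = 1}"

lemma connD: "conn W \<Longrightarrow> adj_closed W A \<Longrightarrow> A \<noteq> {} \<Longrightarrow> A = W"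
  by (auto simp: conn_def)

lemma adj_closed_trans: "adj_closed W K \<Longrightarrow> adj_closed K A \<Longrightarrow> adj_closed W A"
  unfolding adj_closed_def by blast

lemma adj_closed_Diff: "adj_closed W A \<Longrightarrow> adj_closed W (W - A)"
  unfolding adj_closed_def using E_sym by blast

lemma conn_nonempty: "conn W \<Longrightarrow> W \<noteq> {}"
  by (simp add: conn_def)

lemma conn_nb_nonempty:
  assumes "conn W" "v \<in> W" "W \<noteq> {v}"
  shows "nb W v \<noteq> {}"
proof
  assume "nb W v = {}"
  then have "adj_closed W {v}"
    using assms(2) E_sym by (auto simp: adj_closed_def nb_def)
  then show False
    using connD[OF assms(1)] assms(3) by blast
qed

lemma compsD:
  assumes "C \<in> comps W"
  shows "C \<subseteq> W" "conn C" "C \<noteq> {}" "\<And>u v. u \<in> C \<Longrightarrow> v \<in> W \<Longrightarrow> (u, v) \<in> E \<Longrightarrow> v \<in> C"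
  using assms by (auto simp: comps_def adj_closed_def conn_def)

lemma finite_comps: "finite W \<Longrightarrow> finite (comps W)"
  by (rule finite_subset[of _ "Pow W"]) (auto dest: compsD)

text \<open>The least closed set \<open>K\<close> containing \<open>u\<close> is connected: a
  nonempty closed part of \<open>K\<close> either contains \<open>u\<close> and is everything, or
  its complement in \<open>K\<close> is closed, contains \<open>u\<close> and is everything, which
  is impossible.\<close>

lemma comps_cover: "\<Union>(comps W) = W"
proof
  show "\<Union>(comps W) \<subseteq> W"
    by (auto dest: compsD)
next
  show "W \<subseteq> \<Union>(comps W)"
  proof
    fix u assume "u \<in> W"
    define K where "K = \<Inter>{A. adj_closed W A \<and> u \<in> A}"
    have W: "adj_closed W W"
      by (auto simp: adj_closed_def)
    have K: "adj_closed W K"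
      using W \<open>u \<in> W\<close> unfolding K_def adj_closed_def by blast
    have "u \<in> K"
      by (auto simp: K_def)
    have least: "K \<subseteq> A" if "adj_closed W A" "u \<in> A" for A
      using that by (auto simp: K_def)
    have "conn K"
      unfolding conn_def
    proof (intro conjI allI impI)
      show "K \<noteq> {}"
        using \<open>u \<in> K\<close> by blast
    next
      fix A assume A: "adj_closed K A" "A \<noteq> {}"
      have "A \<subseteq> K"
        using A by (simp add: adj_closed_def)
      show "A = K"
      proof (cases "u \<in> A")
        case True
        then show ?thesis
          using least[of A] adj_closed_trans[OF K A(1)] \<open>A \<subseteq> K\<close> by blast
      next
        case False
        then have "K \<subseteq> K - A"
          using least[of "K - A"] adj_closed_trans[OF K adj_closed_Diff[OF A(1)]] \<open>u \<in> K\<close> by blast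
        then show ?thesis
          using A \<open>A \<subseteq> K\<close> by blast
      qed
    qed
    then show "u \<in> \<Union>(comps W)"
      using K \<open>u \<in> K\<close> by (auto simp: comps_def)
  qed
qed

lemma comps_disjoint:
  assumes "C \<in> comps W" "D \<in> comps W" "C \<noteq> D"
  shows "C \<inter> D = {}"
proof (rule ccontr)
  assume ne: "C \<inter> D \<noteq> {}"
  have "adj_closed C (C \<inter> D)" "adj_closed D (C \<inter> D)"
    using compsD[OF assms(1)] compsD[OF assms(2)] by (auto simp: adj_closed_def)
  then have "C \<inter> D = C" "C \<inter> D = D"
    using connD compsD(2) assms ne by blast+
  then show False
    using assms(3) by blast
qed

lemma nb_comps:
  assumes "C \<in> comps W" "v \<in> C"
  shows "nb W v = nb C v"
  using compsD[OF assms(1)] assms(2) E_sym by (auto simp: nb_def)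

lemma nb_insert: "nb (insert x W) v = (if (x, v) \<in> E then insert x (nb W v) else nb W v)"
  by (auto simp: nb_def)

lemma card_nb_del:
  assumes "finite W" "x \<in> W" "C \<in> comps (W - {x})" "v \<in> C"
  shows "card (nb W v) = card (nb C v) + (if v \<in> nb C x then 1 else 0)"
proof -
  have W: "insert x (W - {x}) = W"
    using assms(2) by blast
  have "nb W v = (if (x, v) \<in> E then insert x (nb C v) else nb C v)"
    using nb_insert[of x "W - {x}" v] nb_comps[OF assms(3,4)] W by simp
  moreover have "x \<notin> nb C v"
    using compsD(1)[OF assms(3)] by (auto simp: nb_def)
  moreover have "finite (nb C v)"
    using compsD(1)[OF assms(3)] assms(1) by (meson finite_Diff finite_nb finite_subset)
  moreover have "v \<in> nb C x \<longleftrightarrow> (x, v) \<in> E"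
    using assms(4) E_sym by (auto simp: nb_def)
  ultimately show ?thesis
    by auto
qed

lemma nb_del: "x \<in> W \<Longrightarrow> nb W x = (\<Union>C\<in>comps (W - {x}). nb C x)"
  using comps_cover[of "W - {x}"] E_irrefl unfolding nb_def by blast

lemma comp_nb_nonempty:
  assumes "conn W" "x \<in> W" "C \<in> comps (W - {x})"
  shows "nb C x \<noteq> {}"
proof
  assume e: "nb C x = {}"
  have "adj_closed W C"
    using compsD[OF assms(3)] e E_sym by (auto simp: adj_closed_def nb_def)
  then have "C = W"
    using connD assms(1) compsD(3)[OF assms(3)] by blast
  then show False
    using compsD(1)[OF assms(3)] assms(2) by blast
qed

lemma comp_nb_pos:
  assumes "finite W" "conn W" "x \<in> W" "C \<in> comps (W - {x})"
  shows "1 \<le> card (nb C x)"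
  using comp_nb_nonempty[OF assms(2-4)] compsD(1)[OF assms(4)] assms(1)
  by (metis One_nat_def Suc_leI card_gt_0_iff finite_Diff finite_nb finite_subset)

section \<open>Edge counts and the cyclomatic number under vertex deletion\<close>

lemma finite_eds: "finite W \<Longrightarrow> finite (eds W)"
  by (rule finite_subset[of _ "Pow W"]) (auto simp: eds_def)

lemma eds_insert: "eds (insert x W) = eds W \<union> (\<lambda>v. {x, v}) ` nb W x"
proof (intro equalityI subsetI)
  fix e assume "e \<in> eds (insert x W)"
  then obtain u v where e: "e = {u, v}" "(u, v) \<in> E" "u \<in> insert x W" "v \<in> insert x W"
    by (auto simp: eds_def)
  have "u \<noteq> v"
    using e(2) E_irrefl by blast
  then consider "u \<in> W" "v \<in> W" | "u = x" "v \<in> W" | "v = x" "u \<in> W"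
    using e(3,4) by blast
  then show "e \<in> eds W \<union> (\<lambda>v. {x, v}) ` nb W x"
  proof cases
    case 1
    then show ?thesis using e by (auto simp: eds_def)
  next
    case 2
    then have "v \<in> nb W x" using E_sym[OF e(2)] by (simp add: nb_def)
    then show ?thesis using 2 e(1) by blast
  next
    case 3
    then have "u \<in> nb W x" using e(2) by (simp add: nb_def)
    then show ?thesis using 3 e(1) by blast
  qed
next
  fix e assume "e \<in> eds W \<union> (\<lambda>v. {x, v}) ` nb W x"
  then consider "e \<in> eds W" | v where "e = {v, x}" "v \<in> W" "(v, x) \<in> E"
    by (auto simp: nb_def)
  then show "e \<in> eds (insert x W)"
    by cases (auto simp: eds_def)
qed

lemma card_eds_insert:
  assumes "finite W" "x \<notin> W"
  shows "card (eds (insert x W)) = card (eds W) + card (nb W x)"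
proof -
  have "eds W \<inter> (\<lambda>v. {x, v}) ` nb W x = {}"
    using assms(2) by (auto simp: eds_def doubleton_eq_iff)
  moreover have "inj_on (\<lambda>v. {x, v}) (nb W x)"
    by (auto simp: inj_on_def doubleton_eq_iff)
  ultimately show ?thesis
    unfolding eds_insert using assms(1) finite_eds finite_nb
    by (subst card_Un_disjoint) (auto simp: card_image)
qed

lemma eds_comps: "eds W = (\<Union>C\<in>comps W. eds C)"
proof
  show "eds W \<subseteq> (\<Union>C\<in>comps W. eds C)"
  proof
    fix e assume "e \<in> eds W"
    then obtain u v where e: "e = {u, v}" "(u, v) \<in> E" "u \<in> W" "v \<in> W"
      by (auto simp: eds_def)
    obtain C where "C \<in> comps W" "u \<in> C"
      using comps_cover e(3) by blast
    then show "e \<in> (\<Union>C\<in>comps W. eds C)"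
      using compsD(4)[of C W u v] e by (auto simp: eds_def)
  qed
  show "(\<Union>C\<in>comps W. eds C) \<subseteq> eds W"
    using compsD(1) by (fastforce simp: eds_def)
qed

lemma card_eds_comps:
  assumes "finite W"
  shows "card (eds W) = (\<Sum>C\<in>comps W. card (eds C))"
  unfolding eds_comps[of W]
proof (rule card_UN_disjoint)
  show "\<forall>C\<in>comps W. finite (eds C)"
    using assms compsD(1) finite_eds finite_subset by metis
  have "e \<subseteq> C \<and> e \<noteq> {}" if "e \<in> eds C" for e C
    using that by (auto simp: eds_def)
  then show "\<forall>C\<in>comps W. \<forall>D\<in>comps W. C \<noteq> D \<longrightarrow> eds C \<inter> eds D = {}"
    using comps_disjoint by (metis (no_types) disjoint_iff inf.bounded_iff subset_empty)
qed (simp add: finite_comps assms)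

lemma card_comps:
  assumes "finite W"
  shows "card W = (\<Sum>C\<in>comps W. card C)"
proof -
  have "card (\<Union>C\<in>comps W. C) = (\<Sum>C\<in>comps W. card C)"
    using comps_disjoint finite_comps[OF assms] compsD(1) finite_subset[OF _ assms]
    by (intro card_UN_disjoint) auto
  then show ?thesis
    using comps_cover[of W] by simp
qed

text \<open>The edges at \<open>x\<close> are distributed over the components. The vertex
  \<open>x\<close> itself cancels the summand 1 of \<open>cyc_num W\<close>, and each -1 on the
  right undoes the summand 1 of \<open>cyc_num C\<close>.\<close>

lemma cyc_num_del:
  assumes "finite W" "x \<in> W"
  shows "cyc_num W = (\<Sum>C\<in>comps (W - {x}). cyc_num C + (int (card (nb C x)) - 1))"
proof -
  let ?K = "comps (W - {x})"
  have W: "W = insert x (W - {x})"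
    using assms(2) by blast
  have "card (eds W) = card (eds (W - {x})) + card (nb (W - {x}) x)"
    using card_eds_insert[of "W - {x}" x] assms W by simp
  also have "nb (W - {x}) x = nb W x"
    using E_irrefl by (auto simp: nb_def)
  also have "card (nb W x) = (\<Sum>C\<in>?K. card (nb C x))"
    unfolding nb_del[OF assms(2)]
  proof (rule card_UN_disjoint)
    show "\<forall>C\<in>?K. finite (nb C x)"
      using assms(1) compsD(1) finite_nb finite_subset by (metis finite_Diff)
    show "\<forall>C\<in>?K. \<forall>D\<in>?K. C \<noteq> D \<longrightarrow> nb C x \<inter> nb D x = {}"
      using comps_disjoint nb_subset by blast
  qed (simp add: finite_comps assms)
  finally have "int (card (eds W)) = (\<Sum>C\<in>?K. int (card (eds C)) + int (card (nb C x)))"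
    using card_eds_comps[of "W - {x}"] assms(1) by (simp add: sum.distrib)
  moreover have "int (card W) = 1 + (\<Sum>C\<in>?K. int (card C))"
    using card_comps[of "W - {x}"] assms by (metis card_Suc_Diff1 finite_Diff int_Suc add.commute of_nat_sum)
  ultimately show ?thesis
    by (simp add: cyc_num_def sum.distrib sum_subtractf)
qed

section \<open>Null vectors and nullity under vertex deletion\<close>

lemma null_vec_comp:
  assumes "C \<in> comps W" "null_vec W z"
  shows "null_vec C z"
  using assms compsD(1)[OF assms(1)] nb_comps[OF assms(1)] unfolding null_vec_def by fastforce

lemma null_vec_del:
  assumes "null_vec W z" "z x = 0" "finite W"
  shows "null_vec (W - {x}) z"
  unfolding null_vec_def
proof
  fix j assume j: "j \<in> W - {x}"
  have "(\<Sum>i\<in>nb (W - {x}) j. z i * \<phi> i j) = (\<Sum>i\<in>nb W j. z i * \<phi> i j)"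
    using assms(2,3) by (intro sum.mono_neutral_left) (auto simp: nb_def)
  then show "(\<Sum>i\<in>nb (W - {x}) j. z i * \<phi> i j) = 0"
    using assms(1) j by (simp add: null_vec_def)
qed

text \<open>One optimal determining set is chosen per component. The union bound speaks of
  subfamilies because the leaf case leaves one component out.\<close>

lemma comp_witnesses:
  assumes "finite W"
  obtains S where "\<And>C. C \<in> comps W \<Longrightarrow> determ C (S C)"
    "\<And>K. K \<subseteq> comps W \<Longrightarrow> card (\<Union>C\<in>K. S C) \<le> (\<Sum>C\<in>K. nullity C)"
proof -
  have "\<forall>C. \<exists>S. determ C S \<and> card S = nullity C"
  proof
    show "\<exists>S. determ C S \<and> card S = nullity C" for C
      by (rule nullity_witness[of C]) blast
  qed
  then obtain S where S: "\<And>C. determ C (S C)" "\<And>C. card (S C) = nullity C"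
    by metis
  show ?thesis
  proof
    show "card (\<Union>C\<in>K. S C) \<le> (\<Sum>C\<in>K. nullity C)" if "K \<subseteq> comps W" for K
      using card_UN_le[OF finite_subset[OF that finite_comps[OF assms]], of S] by (simp add: S(2))
  qed (rule S)
qed

text \<open>A null vector that vanishes at \<open>x\<close> restricts to a null vector of every
  component, so \<open>x\<close> together with determining sets of the components is
  determining.\<close>

lemma nullity_del:
  assumes "finite W" "x \<in> W"
  shows "nullity W \<le> 1 + (\<Sum>C\<in>comps (W - {x}). nullity C)"
proof -
  let ?K = "comps (W - {x})"
  obtain S where S: "\<And>C. C \<in> ?K \<Longrightarrow> determ C (S C)"
    "\<And>K. K \<subseteq> ?K \<Longrightarrow> card (\<Union>C\<in>K. S C) \<le> (\<Sum>C\<in>K. nullity C)"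
    using comp_witnesses[of "W - {x}"] assms(1) by auto
  have "determ W (insert x (\<Union>C\<in>?K. S C))"
    unfolding determ_def
  proof (intro conjI allI impI ballI)
    show "insert x (\<Union>C\<in>?K. S C) \<subseteq> W"
      using S(1) compsD(1) assms(2) unfolding determ_def by fast
  next
    fix z i
    assume z: "null_vec W z" "\<forall>i\<in>insert x (\<Union>C\<in>?K. S C). z i = 0" and i: "i \<in> W"
    show "z i = 0"
    proof (cases "i = x")
      case False
      then obtain C where C: "C \<in> ?K" "i \<in> C"
        using comps_cover[of "W - {x}"] i by blast
      have "null_vec C z"
        using null_vec_comp[OF C(1)] null_vec_del z assms(1) by blast
      then show ?thesis
        using S(1)[OF C(1)] z C unfolding determ_def by blast
    qed (use z in simp)
  qed
  then have "nullity W \<le> card (insert x (\<Union>C\<in>?K. S C))"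
    by (rule nullity_le)
  also have "\<dots> \<le> 1 + card (\<Union>C\<in>?K. S C)"
    by (simp add: card_insert_le_m1)
  finally show ?thesis
    using S(2)[of ?K] by simp
qed

lemma leaf_comp:
  assumes "nb W y = {x}" "y \<in> W"
  shows "{y} \<in> comps (W - {x})"
proof -
  have "v \<notin> W - {x}" if "(y, v) \<in> E" for v
    using assms(1) E_sym[OF that] in_nb_iff[of v W y] by blast
  moreover have "y \<noteq> x"
    using assms(1) E_irrefl[of x] in_nb_iff[of x W y] by blast
  ultimately have "adj_closed (W - {x}) {y}"
    using assms(2) unfolding adj_closed_def by blast
  moreover have "conn {y}"
    by (auto simp: conn_def adj_closed_def)
  ultimately show ?thesis
    by (simp add: comps_def)
qed

text \<open>The equation at the leaf \<open>y\<close> has the single term of \<open>x\<close> and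
  forces \<open>z x = 0\<close> at no cost. Once all other components vanish, the equation at
  \<open>x\<close> has the single term of \<open>y\<close> left, so \<open>y\<close> costs nothing
  either.\<close>

lemma nullity_leaf:
  assumes "finite W" "y \<in> W" "nb W y = {x}"
  shows "nullity W \<le> (\<Sum>C\<in>comps (W - {x}) - {{y}}. nullity C)"
proof -
  let ?K = "comps (W - {x}) - {{y}}"
  have x: "x \<in> W" "(x, y) \<in> E" "x \<noteq> y"
    using assms(3) E_irrefl by (auto simp: nb_def)
  have yK: "{y} \<in> comps (W - {x})"
    using leaf_comp assms by blast
  obtain S where S: "\<And>C. C \<in> ?K \<Longrightarrow> determ C (S C)"
    "\<And>K. K \<subseteq> ?K \<Longrightarrow> card (\<Union>C\<in>K. S C) \<le> (\<Sum>C\<in>K. nullity C)"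
  proof -
    obtain S where "\<And>C. C \<in> comps (W - {x}) \<Longrightarrow> determ C (S C)"
      "\<And>K. K \<subseteq> comps (W - {x}) \<Longrightarrow> card (\<Union>C\<in>K. S C) \<le> (\<Sum>C\<in>K. nullity C)"
      using comp_witnesses[of "W - {x}"] assms(1) by auto
    then show ?thesis
      using that[of S] by blast
  qed
  have "determ W (\<Union>C\<in>?K. S C)"
    unfolding determ_def
  proof (intro conjI allI impI ballI)
    show "(\<Union>C\<in>?K. S C) \<subseteq> W"
      using S(1) compsD(1) unfolding determ_def by fast
  next
    fix z i
    assume z: "null_vec W z" "\<forall>i\<in>(\<Union>C\<in>?K. S C). z i = 0" and i: "i \<in> W"
    have "(\<Sum>i\<in>nb W y. z i * \<phi> i y) = 0"
      using z(1) assms(2) unfolding null_vec_def by blast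
    then have "z x * \<phi> x y = 0"
      unfolding assms(3) by simp
    then have zx: "z x = 0"
      using gain_nonzero[OF x(2)] by (metis mult_eq_0_iff)
    have rest: "z j = 0" if "j \<in> W" "j \<noteq> y" for j
    proof (cases "j = x")
      case False
      then have "j \<in> \<Union>(comps (W - {x}))"
        using comps_cover[of "W - {x}"] that(1) by simp
      then obtain C where C: "C \<in> comps (W - {x})" "j \<in> C"
        by blast
      have CK: "C \<in> ?K"
        using C that(2) by auto
      have "null_vec C z"
        using null_vec_comp[OF C(1)] null_vec_del[OF z(1) zx assms(1)] by blast
      moreover have "\<forall>i\<in>S C. z i = 0"
        using z(2) CK by blast
      ultimately show ?thesis
        using S(1)[OF CK] C(2) unfolding determ_def by blast
    qed (use zx in simp)
    have "(\<Sum>i\<in>nb W x. z i * \<phi> i x) = 0"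
      using z(1) x(1) by (simp add: null_vec_def)
    moreover have "(\<Sum>i\<in>nb W x. z i * \<phi> i x) = (\<Sum>i\<in>{y}. z i * \<phi> i x)"
    proof (rule sum.mono_neutral_right)
      show "finite (nb W x)"
        using finite_nb assms(1) .
      show "{y} \<subseteq> nb W x"
        using E_sym[OF x(2)] assms(2) by (simp add: nb_def)
      show "\<forall>i\<in>nb W x - {y}. z i * \<phi> i x = 0"
        using rest nb_subset[of W x] by (metis Diff_iff insertCI mult_zero_left subsetD)
    qed
    ultimately have "z y = 0"
      using gain_nonzero[OF E_sym[OF x(2)]] by simp
    then show "z i = 0"
      using rest[OF i] by (cases "i = y") auto
  qed
  then have "nullity W \<le> card (\<Union>C\<in>?K. S C)"
    by (rule nullity_le)
  then show ?thesis
    using S(2)[OF subset_refl] by (rule order_trans)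
qed

text \<open>Induction on the size: after deleting any vertex every component contributes a
  nonnegative amount, since connectedness gives it at least one edge to that vertex.\<close>

lemma cyc_num_nonneg:
  assumes "finite W" "conn W"
  shows "0 \<le> cyc_num W"
  using assms
proof (induction "card W" arbitrary: W rule: less_induct)
  case less
  obtain x where x: "x \<in> W"
    using conn_nonempty[OF less.prems(2)] by blast
  have "0 \<le> cyc_num C + (int (card (nb C x)) - 1)" if C: "C \<in> comps (W - {x})" for C
  proof -
    have "C \<subset> W"
      using compsD(1)[OF C] x by blast
    then have "0 \<le> cyc_num C"
      using less compsD(2)[OF C] by (meson finite_subset psubset_card_mono psubset_imp_subset)
    then show ?thesis
      using comp_nb_pos[OF less.prems x C] by linarith
  qed
  then show ?case
    unfolding cyc_num_del[OF less.prems(1) x] by (rule sum_nonneg)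
qed

lemma cyc_num_pos:
  assumes "finite W" "conn W" "x \<in> W" "C \<in> comps (W - {x})" "2 \<le> card (nb C x)"
  shows "1 \<le> cyc_num W"
proof -
  have nn: "0 \<le> cyc_num D + (int (card (nb D x)) - 1)" if D: "D \<in> comps (W - {x})" for D
  proof -
    have "finite D"
      using compsD(1)[OF D] assms(1) finite_subset by blast
    then show ?thesis
      using comp_nb_pos[OF assms(1-3) D] cyc_num_nonneg[of D] compsD(2)[OF D] by linarith
  qed
  have "0 \<le> cyc_num C"
    using cyc_num_nonneg[of C] compsD(1,2)[OF assms(4)] assms(1) by (meson finite_Diff finite_subset)
  then have "1 \<le> cyc_num C + (int (card (nb C x)) - 1)"
    using assms(5) by linarith
  also have "\<dots> \<le> cyc_num W"
    unfolding cyc_num_del[OF assms(1,3)] using assms(1,4) nn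
    by (intro member_le_sum) (auto simp: finite_comps)
  finally show ?thesis .
qed

end

subsection \<open>Cycles\<close>

lemma length_cyc_pairs [simp]: "length (cyc_pairs us) = length us"
  by (simp add: cyc_pairs_def)

lemma nth_cyc_pairs: "k < length us \<Longrightarrow> cyc_pairs us ! k = (us ! k, us ! (Suc k mod length us))"
  by (simp add: cyc_pairs_def nth_rotate1)

lemma zip_rotate1: "length xs = length ys \<Longrightarrow> zip (rotate1 xs) (rotate1 ys) = rotate1 (zip xs ys)"
  by (cases xs; cases ys) auto

lemma cyc_pairs_rotate1: "cyc_pairs (rotate1 us) = rotate1 (cyc_pairs us)"
  by (simp add: cyc_pairs_def zip_rotate1)

lemma set_cyc_pairs: "set (cyc_pairs us) = (\<lambda>k. (us ! k, us ! (Suc k mod length us))) ` {..<length us}"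
proof -
  have "set (cyc_pairs us) = (!) (cyc_pairs us) ` {..<length us}"
    by (auto simp: set_conv_nth)
  then show ?thesis
    by (simp add: nth_cyc_pairs)
qed

lemma sign_square: "(-1) ^ n * (-1) ^ n = (1 :: quat)"
  by (cases "even n") auto

definition cyc_gain :: "('a \<Rightarrow> 'a \<Rightarrow> quat) \<Rightarrow> 'a list \<Rightarrow> quat" where
  "cyc_gain \<phi> us = prod_list (map (\<lambda>(u, v). \<phi> u v) (cyc_pairs us))"

text \<open>The gain product changes by conjugation, and a sign is central.\<close>

lemma cyc_gain_rotate1:
  assumes "cyc_gain \<phi> us = (-1) ^ n"
  shows "cyc_gain \<phi> (rotate1 us) = (-1) ^ n"
proof (cases "cyc_pairs us")
  case Nil
  then show ?thesis using assms by (simp add: cyc_gain_def cyc_pairs_rotate1)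
next
  case (Cons q qs)
  define p R where "p = (case q of (u, v) \<Rightarrow> \<phi> u v)"
    and "R = prod_list (map (\<lambda>(u, v). \<phi> u v) qs)"
  have pR: "p * R = (-1) ^ n" and goal: "cyc_gain \<phi> (rotate1 us) = R * p"
    using assms by (simp_all add: cyc_gain_def cyc_pairs_rotate1 Cons p_def R_def)
  have sgn: "((-1) ^ n :: quat) = 1 \<or> ((-1) ^ n :: quat) = -1"
    by (cases "even n") auto
  then have "p \<noteq> 0"
    using pR by auto
  have "R * p = inverse p * (p * R) * p"
    using \<open>p \<noteq> 0\<close> by (simp add: mult.assoc[symmetric])
  also have "\<dots> = (-1) ^ n"
    using sgn \<open>p \<noteq> 0\<close> unfolding pR by auto
  finally show ?thesis
    using goal by simp
qed

context gained begin

definition cyc_list :: "'a set \<Rightarrow> 'a list \<Rightarrow> bool" where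
  "cyc_list D us \<longleftrightarrow> 3 \<le> length us \<and> distinct us \<and> set us = D
     \<and> E \<inter> D \<times> D = set (cyc_pairs us) \<union> (set (cyc_pairs us))\<inverse>"

definition type1 :: "'a set \<Rightarrow> bool" where
  "type1 D \<longleftrightarrow> (\<exists>us. cyc_list D us \<and> even (length us) \<and> cyc_gain \<phi> us = (-1) ^ (length us div 2))"

lemma cyc_list_rotate1: "cyc_list D us \<Longrightarrow> cyc_list D (rotate1 us)"
  by (simp add: cyc_list_def cyc_pairs_rotate1)

text \<open>A gain product equal to a sign survives rotation, so the listing may start at any
  vertex; below this is the vertex where the cycle is attached.\<close>

lemma type1_based:
  assumes "type1 D" "a \<in> D"
  obtains us where "cyc_list D us" "even (length us)" "cyc_gain \<phi> us = (-1) ^ (length us div 2)"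
    "us ! 0 = a"
proof -
  obtain us where us: "cyc_list D us" "even (length us)" "cyc_gain \<phi> us = (-1) ^ (length us div 2)"
    using assms(1) type1_def by blast
  obtain i where i: "i < length us" "us ! i = a"
    using us(1) assms(2) by (auto simp: cyc_list_def in_set_conv_nth)
  have "cyc_list D (rotate n us)" "cyc_gain \<phi> (rotate n us) = (-1) ^ (length us div 2)" for n
    using us by (induction n) (simp_all add: cyc_list_rotate1 cyc_gain_rotate1)
  moreover have "rotate i us ! 0 = a"
    using i nth_rotate[of 0 us i] by (cases us) auto
  ultimately show ?thesis
    using that[of "rotate i us"] us(2) by simp
qed

context
  fixes D us m
  assumes cl: "cyc_list D us" and m_def: "m = length us"
begin

lemma cyc_list_length: "3 \<le> m"
  using cl by (simp add: cyc_list_def m_def)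

lemma cyc_list_nth_eq_iff: "i < m \<Longrightarrow> j < m \<Longrightarrow> us ! i = us ! j \<longleftrightarrow> i = j"
  using cl by (simp add: cyc_list_def m_def nth_eq_iff_index_eq)

lemma cyc_list_eq_image: "D = (!) us ` {..<m}"
  using cl by (auto simp: cyc_list_def m_def set_conv_nth)

lemma finite_cyc_list: "finite D"
  by (simp add: cyc_list_eq_image)

lemma card_cyc_list: "card D = m"
  using cl distinct_card by (fastforce simp: cyc_list_def m_def)

lemma cyc_list_adj: "k < m \<Longrightarrow> (us ! k, us ! (Suc k mod m)) \<in> E"
  using cl by (auto simp: cyc_list_def m_def set_cyc_pairs)

lemma cyc_list_adj_iff:
  assumes "i < m" "j < m"
  shows "(us ! i, us ! j) \<in> E \<longleftrightarrow> j = Suc i mod m \<or> i = Suc j mod m"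
proof -
  have "us ! i \<in> D" "us ! j \<in> D"
    using assms by (auto simp: cyc_list_eq_image)
  then have "(us ! i, us ! j) \<in> E \<longleftrightarrow> (us ! i, us ! j) \<in> E \<inter> D \<times> D"
    by simp
  also have "\<dots> \<longleftrightarrow> (\<exists>k<m. us ! i = us ! k \<and> us ! j = us ! (Suc k mod m))
    \<or> (\<exists>k<m. us ! j = us ! k \<and> us ! i = us ! (Suc k mod m))"
    using cl by (auto simp: cyc_list_def m_def set_cyc_pairs)
  also have "\<dots> \<longleftrightarrow> j = Suc i mod m \<or> i = Suc j mod m"
  proof -
    have "Suc k mod m < m" for k
      using cyc_list_length by simp
    then show ?thesis
      using assms cyc_list_nth_eq_iff by metis
  qed
  finally show ?thesis .
qed

text \<open>Position 0 is left to a separate lemma, because its predecessor is \<open>m - 1\<close>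
  and not \<open>k - 1\<close>.\<close>

lemma nb_cyc_list:
  assumes "0 < k" "k < m"
  shows "nb D (us ! k) = {us ! (k - 1), us ! (Suc k mod m)}" "us ! (k - 1) \<noteq> us ! (Suc k mod m)"
proof -
  have *: "Suc k mod m < m"
    using cyc_list_length by simp
  have iff: "(us ! i, us ! k) \<in> E \<longleftrightarrow> i = k - 1 \<or> i = Suc k mod m" if "i < m" for i
    unfolding cyc_list_adj_iff[OF that assms(2)] using assms that by (auto simp: mod_Suc)
  show "nb D (us ! k) = {us ! (k - 1), us ! (Suc k mod m)}"
    using iff[of "k - 1"] iff[of "Suc k mod m"] iff * assms by (auto simp: nb_def cyc_list_eq_image)
  have "k - 1 \<noteq> Suc k mod m"
    using assms cyc_list_length by (auto simp: mod_Suc)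
  then show "us ! (k - 1) \<noteq> us ! (Suc k mod m)"
    using cyc_list_nth_eq_iff[of "k - 1" "Suc k mod m"] * assms by auto
qed

lemma nb_cyc_list_0: "nb D (us ! 0) = {us ! (m - 1), us ! 1}" "us ! (m - 1) \<noteq> us ! 1"
proof -
  have iff: "(us ! i, us ! 0) \<in> E \<longleftrightarrow> i = m - 1 \<or> i = 1" if "i < m" for i
    using cyc_list_adj_iff[OF that, of 0] cyc_list_length that by (auto simp: mod_Suc)
  show "nb D (us ! 0) = {us ! (m - 1), us ! 1}"
    using iff[of "m - 1"] iff[of 1] iff cyc_list_length by (auto simp: nb_def cyc_list_eq_image)
  show "us ! (m - 1) \<noteq> us ! 1"
    using cyc_list_nth_eq_iff[of "m - 1" 1] cyc_list_length by simp
qed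

lemma card_nb_cyc_list: "v \<in> D \<Longrightarrow> card (nb D v) = 2"
proof -
  assume "v \<in> D"
  then obtain k where "k < m" "v = us ! k"
    by (auto simp: cyc_list_eq_image)
  then show "card (nb D v) = 2"
    using nb_cyc_list[of k] nb_cyc_list_0 by (cases "k = 0") auto
qed

lemma card_eds_cyc_list: "card (eds D) = m"
proof -
  have "eds D = (\<lambda>k. {us ! k, us ! (Suc k mod m)}) ` {..<m}"
  proof (intro equalityI subsetI)
    fix e assume "e \<in> eds D"
    then obtain i j where e: "e = {us ! i, us ! j}" "(us ! i, us ! j) \<in> E" "i < m" "j < m"
      by (auto simp: eds_def cyc_list_eq_image)
    then show "e \<in> (\<lambda>k. {us ! k, us ! (Suc k mod m)}) ` {..<m}"
      using cyc_list_adj_iff[of i j] by auto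
  next
    fix e assume "e \<in> (\<lambda>k. {us ! k, us ! (Suc k mod m)}) ` {..<m}"
    then obtain k where k: "k < m" "e = {us ! k, us ! (Suc k mod m)}"
      by blast
    then have "us ! k \<in> D" "us ! (Suc k mod m) \<in> D"
      using cyc_list_length by (auto simp: cyc_list_eq_image)
    then show "e \<in> eds D"
      using cyc_list_adj[OF k(1)] k(2) unfolding eds_def by blast
  qed
  moreover have "inj_on (\<lambda>k. {us ! k, us ! (Suc k mod m)}) {..<m}"
  proof (rule inj_onI)
    fix i j assume ij: "i \<in> {..<m}" "j \<in> {..<m}"
      and eq: "{us ! i, us ! (Suc i mod m)} = {us ! j, us ! (Suc j mod m)}"
    have "Suc k mod m < m" for k
      using cyc_list_length by simp
    \<comment> \<open>Distinct positions that are successors of each other would force m =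
      2.\<close>
    then have "i = j \<or> i = Suc j mod m \<and> Suc i mod m = j"
      using eq ij cyc_list_nth_eq_iff unfolding doubleton_eq_iff by (metis lessThan_iff)
    then show "i = j"
      using cyc_list_length ij by (auto simp: mod_Suc split: if_splits)
  qed
  ultimately show ?thesis
    by (simp add: card_image)
qed

lemma cyc_num_cyc_list: "cyc_num D = 1"
  by (simp add: cyc_num_def card_eds_cyc_list card_cyc_list)

text \<open>The signed gains of the initial segments of the cycle. Along the cycle a null vector is,
  separately on the even and on the odd positions, a constant times them.\<close>

definition pgain :: "nat \<Rightarrow> quat" where
  "pgain k = (-1) ^ (k div 2) * prod_list (map (\<lambda>(u, v). \<phi> u v) (take k (cyc_pairs us)))"

lemma pgain_0: "pgain 0 = 1"
  by (simp add: pgain_def)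

lemma prod_take_Suc:
  assumes "k < m"
  shows "prod_list (map (\<lambda>(u, v). \<phi> u v) (take (Suc k) (cyc_pairs us)))
    = prod_list (map (\<lambda>(u, v). \<phi> u v) (take k (cyc_pairs us))) * \<phi> (us ! k) (us ! (Suc k mod m))"
  using assms by (simp add: take_Suc_conv_app_nth m_def nth_cyc_pairs)

lemma pgain_1: "pgain 1 = \<phi> (us ! 0) (us ! 1)"
  using cyc_list_length prod_take_Suc[of 0] by (simp add: pgain_def)

text \<open>Advancing by two positions multiplies by two gains and flips the sign. The equation at
  position \<open>k\<close> imposes the same recursion on a null vector.\<close>

lemma pgain_step:
  assumes "0 < k" "k < m"
  shows "pgain (Suc k) = - (pgain (k - 1) * \<phi> (us ! (k - 1)) (us ! k) * \<phi> (us ! k) (us ! (Suc k mod m)))"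
proof -
  have "(-1) ^ (Suc k div 2) = - ((-1 :: quat) ^ ((k - 1) div 2))"
    using assms(1) by (cases k) auto
  moreover have "Suc (k - 1) = k" "Suc (k - 1) mod m = k"
    using assms by auto
  ultimately show ?thesis
    using prod_take_Suc[of "k - 1"] prod_take_Suc[of k] assms by (simp add: pgain_def mult.assoc)
qed

lemma pgain_last: "even m \<Longrightarrow> pgain m = (-1) ^ (m div 2) * cyc_gain \<phi> us"
  by (simp add: pgain_def m_def cyc_gain_def)

text \<open>The last arc completes the gain product around the cycle, but the sign exponent at
  \<open>m - 1\<close> is one less than \<open>m div 2\<close>; hence -1.\<close>

lemma pgain_penultimate:
  assumes "even m" "cyc_gain \<phi> us = (-1) ^ (m div 2)"
  shows "pgain (m - 1) * \<phi> (us ! (m - 1)) (us ! 0) = - 1"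
proof -
  have m: "Suc (m - 1) = m" "Suc (m - 1) mod m = 0"
    using cyc_list_length by auto
  obtain h where h: "m = 2 * Suc h"
    using assms(1) cyc_list_length by (metis evenE not0_implies_Suc mult_0_right not_numeral_le_zero)
  have "pgain (m - 1) * \<phi> (us ! (m - 1)) (us ! 0) = (-1) ^ ((m - 1) div 2) * cyc_gain \<phi> us"
    using prod_take_Suc[of "m - 1"] m cyc_list_length by (simp add: pgain_def mult.assoc cyc_gain_def m_def)
  then show ?thesis
    using h assms(2) by (simp add: sign_square)
qed

text \<open>Given the value before position \<open>k\<close>, the equation there fixes the value
  after it. The forward direction propagates a null vector along the cycle, the backward direction
  verifies a constructed one.\<close>

lemma null_eq_iff:
  assumes k: "0 < k" "k < m" and z: "z (us ! (k - 1)) = t * pgain (k - 1)"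
  shows "(\<Sum>i\<in>nb D (us ! k). z i * \<phi> i (us ! k)) = 0 \<longleftrightarrow> z (us ! (Suc k mod m)) = t * pgain (Suc k)"
proof -
  define a b c where "a = us ! (k - 1)" and "b = us ! k" and "c = us ! (Suc k mod m)"
  have bc: "\<phi> b c * \<phi> c b = 1" "\<phi> c b * \<phi> b c = 1"
    using gain_mult cyc_list_adj[OF k(2)] E_sym by (auto simp: b_def c_def)
  have "(\<Sum>i\<in>nb D (us ! k). z i * \<phi> i (us ! k)) = z a * \<phi> a b + z c * \<phi> c b"
    using nb_cyc_list[OF k] by (simp add: a_def b_def c_def)
  also have "\<dots> = 0 \<longleftrightarrow> z c * \<phi> c b = - (z a * \<phi> a b)"
    by (metis add.commute add_eq_0_iff)
  also have "\<dots> \<longleftrightarrow> z c = - (z a * \<phi> a b) * \<phi> b c"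
  proof
    assume "z c * \<phi> c b = - (z a * \<phi> a b)"
    then have "z c * (\<phi> c b * \<phi> b c) = - (z a * \<phi> a b) * \<phi> b c"
      by (simp add: mult.assoc[symmetric])
    then show "z c = - (z a * \<phi> a b) * \<phi> b c"
      by (simp add: bc)
  next
    assume "z c = - (z a * \<phi> a b) * \<phi> b c"
    then have "z c * \<phi> c b = - (z a * \<phi> a b) * (\<phi> b c * \<phi> c b)"
      by (simp add: mult.assoc)
    then show "z c * \<phi> c b = - (z a * \<phi> a b)"
      by (simp add: bc)
  qed
  also have "- (z a * \<phi> a b) * \<phi> b c = t * pgain (Suc k)"
    using pgain_step[OF k] z by (simp add: a_def b_def c_def mult.assoc)
  finally show ?thesis
    by (simp add: c_def)
qed

text \<open>Only the equations at positions other than 0 are assumed, since position 0 will be the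
  attaching vertex, whose equation has further terms. If \<open>r + 2 * j = m\<close>, the vertex
  wraps around to position 0 while \<open>pgain m\<close> keeps the full product; comparing the two
  gives the closing condition of the cycle.\<close>

lemma null_chain:
  assumes eqs: "\<And>k. 0 < k \<Longrightarrow> k < m \<Longrightarrow> (\<Sum>i\<in>nb D (us ! k). z i * \<phi> i (us ! k)) = 0"
    and start: "z (us ! r) = t * pgain r" "r < m"
  shows "r + 2 * j \<le> m \<Longrightarrow> z (us ! ((r + 2 * j) mod m)) = t * pgain (r + 2 * j)"
proof (induction j)
  case 0
  then show ?case using start by simp
next
  case (Suc j)
  have "z (us ! (Suc (r + 2 * j) - 1)) = t * pgain (Suc (r + 2 * j) - 1)"
    using Suc by simp
  then show ?case
    using null_eq_iff[of "Suc (r + 2 * j)" z t] eqs[of "Suc (r + 2 * j)"] Suc.prems by simp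
qed

text \<open>This is the chain with \<open>t = 0\<close>; the values 0 and 1 of \<open>r\<close>
  start the even and the odd positions.\<close>

lemma null_zero:
  assumes eqs: "\<And>k. 0 < k \<Longrightarrow> k < m \<Longrightarrow> (\<Sum>i\<in>nb D (us ! k). z i * \<phi> i (us ! k)) = 0"
    and r: "z (us ! r) = 0" "r \<le> 1" and k: "k < m" "even (k + r)"
  shows "z (us ! k) = 0"
proof -
  have "r < m"
    using cyc_list_length r(2) by simp
  have "r \<le> k"
    using r(2) k(2) by (cases "r = 0") (auto simp: le_Suc_eq intro: Suc_leI odd_pos)
  then obtain j where "k = r + 2 * j"
    using k by (metis even_add evenE le_add_diff_inverse even_diff_nat)
  then show ?thesis
    using null_chain[of z r 0 j, OF eqs] \<open>r < m\<close> r k by simp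
qed

lemma null_zero_all:
  assumes "\<And>k. 0 < k \<Longrightarrow> k < m \<Longrightarrow> (\<Sum>i\<in>nb D (us ! k). z i * \<phi> i (us ! k)) = 0"
    and "z (us ! 0) = 0" "z (us ! 1) = 0" "v \<in> D"
  shows "z v = 0"
proof -
  obtain k where k: "k < m" "v = us ! k"
    using assms(4) by (auto simp: cyc_list_eq_image)
  then show ?thesis
    using null_zero[OF assms(1), of 0 k] null_zero[OF assms(1), of 1 k] assms(2,3)
    by (cases "even k") auto
qed

lemma null_vec_eqs: "null_vec D z \<Longrightarrow> k < m \<Longrightarrow> (\<Sum>i\<in>nb D (us ! k). z i * \<phi> i (us ! k)) = 0"
  unfolding null_vec_def cyc_list_eq_image by blast

lemma nullity_cyc_list_le_2: "nullity D \<le> 2"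
proof -
  have "determ D {us ! 0, us ! 1}"
    unfolding determ_def using null_zero_all null_vec_eqs cyc_list_length by (auto simp: cyc_list_eq_image)
  then show ?thesis
    using nullity_le[of D "{us ! 0, us ! 1}"] card_insert_le_m1[of 2 "{us ! 1}" "us ! 0"] by simp
qed

text \<open>For even \<open>m\<close>, going once around yields
  \<open>z (us ! 0) * (1 - pgain m) = 0\<close>, and \<open>pgain m = 1\<close> would make the cycle
  Type 1; so the even positions vanish and only position 1 has to be prescribed. For odd
  \<open>m\<close>, the zero at position 0 propagates to \<open>m - 1\<close>, and the equation at
  position 0 carries it on to position 1, hence to the odd positions.\<close>

lemma nullity_cyc_list_le_1:
  assumes "\<not> (even m \<and> cyc_gain \<phi> us = (-1) ^ (m div 2))"
  shows "nullity D \<le> 1"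
proof (cases "even m")
  case True
  have "determ D {us ! 1}"
    unfolding determ_def
  proof (intro conjI allI impI ballI)
    show "{us ! 1} \<subseteq> D"
      using cyc_list_length by (auto simp: cyc_list_eq_image)
  next
    fix z v assume z: "null_vec D z" "\<forall>i\<in>{us ! 1}. z i = 0" and v: "v \<in> D"
    obtain h where h: "m = 2 * h"
      using True by blast
    have "z (us ! 0) = z (us ! 0) * pgain m"
      using null_chain[of z 0 "z (us ! 0)" h, OF null_vec_eqs[OF z(1)]] h cyc_list_length by (simp add: pgain_0)
    then have "z (us ! 0) * (1 - pgain m) = 0"
      by (simp add: right_diff_distrib)
    moreover have "pgain m \<noteq> 1"
    proof
      assume "pgain m = 1"
      then have "(-1) ^ (m div 2) * ((-1) ^ (m div 2) * cyc_gain \<phi> us) = (-1) ^ (m div 2)"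
        using pgain_last[OF True] by simp
      then have "(-1) ^ (m div 2) * (-1) ^ (m div 2) * cyc_gain \<phi> us = (-1) ^ (m div 2)"
        by (simp only: mult.assoc)
      then have "cyc_gain \<phi> us = (-1) ^ (m div 2)"
        by (simp add: sign_square)
      then show False
        using assms True by blast
    qed
    ultimately have "z (us ! 0) = 0"
      by (metis eq_iff_diff_eq_0 mult_eq_0_iff)
    then show "z v = 0"
      using null_zero_all[of z v] null_vec_eqs[OF z(1)] z(2) v by simp
  qed
  then show ?thesis
    using nullity_le[of D "{us ! 1}"] by simp
next
  case False
  have "determ D {us ! 0}"
    unfolding determ_def
  proof (intro conjI allI impI ballI)
    show "{us ! 0} \<subseteq> D"
      using cyc_list_length by (auto simp: cyc_list_eq_image)
  next
    fix z v assume z: "null_vec D z" "\<forall>i\<in>{us ! 0}. z i = 0" and v: "v \<in> D"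
    have "z (us ! (m - 1)) = 0"
      using null_zero[of z 0 "m - 1"] null_vec_eqs[OF z(1)] z(2) False cyc_list_length by simp
    moreover have "(\<Sum>i\<in>nb D (us ! 0). z i * \<phi> i (us ! 0)) = 0"
      using null_vec_eqs[OF z(1), of 0] cyc_list_length by simp
    ultimately have "z (us ! 1) * \<phi> (us ! 1) (us ! 0) = 0"
      using nb_cyc_list_0 by simp
    moreover have "\<phi> (us ! 1) (us ! 0) \<noteq> 0"
      using gain_nonzero[OF E_sym[OF cyc_list_adj[of 0]]] cyc_list_length by simp
    ultimately have "z (us ! 1) = 0"
      by (metis mult_eq_0_iff)
    then show "z v = 0"
      using null_zero_all[of z v] null_vec_eqs[OF z(1)] z(2) v by simp
  qed
  then show ?thesis
    using nullity_le[of D "{us ! 0}"] by simp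
qed

end

subsection \<open>Attaching a Type 1 cycle\<close>

context
  fixes W D a
  assumes tD: "type1 D" and DW: "D \<inter> W = {a}" and finW: "finite W"
    and cross: "\<And>u v. u \<in> D - {a} \<Longrightarrow> v \<in> W - {a} \<Longrightarrow> (u, v) \<notin> E"
begin

lemma attach_point_in: "a \<in> D" "a \<in> W"
  using DW by blast+

lemma nb_attach_cycle:
  assumes "v \<in> D - {a}"
  shows "nb (W \<union> D) v = nb D v"
proof -
  have "x \<in> D" if "(x, v) \<in> E" "x \<in> W" for x
    using that assms cross[OF assms, of x] E_sym[OF that(1)] attach_point_in by blast
  then show ?thesis
    by (auto simp: nb_def)
qed

lemma nb_attach_base:
  assumes "v \<in> W - {a}"
  shows "nb (W \<union> D) v = nb W v"
  using assms cross DW by (auto simp: nb_def)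

lemma nb_attach_point:
  "nb (W \<union> D) a = nb W a \<union> nb D a" "nb W a \<inter> nb D a = {}"
proof -
  show "nb (W \<union> D) a = nb W a \<union> nb D a"
    by (rule nb_Un)
  have "a \<notin> nb W a"
    using E_irrefl by (simp add: nb_def)
  then show "nb W a \<inter> nb D a = {}"
    using DW by (auto simp: nb_def)
qed

lemma cyc_list_nth_attach:
  assumes us: "cyc_list D us" "us ! 0 = a" "m = length us" and k: "0 < k" "k < m"
  shows "us ! k \<in> D - {a}"
  using k us(2) cyc_list_nth_eq_iff[OF us(1,3) k(2), of 0] cyc_list_eq_image[OF us(1,3)] by auto

lemma finite_attach: "finite (W \<union> D)"
  using tD finW finite_cyc_list unfolding type1_def by blast

lemma sum_attach_point:
  fixes f :: "'a \<Rightarrow> quat"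
  shows "(\<Sum>i\<in>nb (W \<union> D) a. f i) = (\<Sum>i\<in>nb W a. f i) + (\<Sum>i\<in>nb D a. f i)"
  unfolding nb_attach_point(1) using finite_attach nb_attach_point(2)
  by (intro sum.union_disjoint) (auto simp: finite_nb)

text \<open>The cycle has as many edges as vertices, and one of its vertices is shared with
  \<open>W\<close>.\<close>

lemma cyc_num_attach: "cyc_num (W \<union> D) = cyc_num W + 1"
proof -
  obtain us where us: "cyc_list D us"
    using tD type1_def by blast
  have finD: "finite D"
    using finite_attach by simp
  have "eds (W \<union> D) = eds W \<union> eds D"
  proof (intro equalityI subsetI)
    fix e assume "e \<in> eds (W \<union> D)"
    then obtain u v where e: "e = {u, v}" "(u, v) \<in> E" "u \<in> W \<union> D" "v \<in> W \<union> D"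
      by (auto simp: eds_def)
    have "u \<in> W \<and> v \<in> W \<or> u \<in> D \<and> v \<in> D"
      using e cross[of u v] cross[of v u] E_sym[OF e(2)] attach_point_in by blast
    then show "e \<in> eds W \<union> eds D"
      using e by (auto simp: eds_def)
  qed (auto simp: eds_def)
  moreover have "eds W \<inter> eds D = {}"
  proof (rule ccontr)
    assume "eds W \<inter> eds D \<noteq> {}"
    then obtain e where e: "e \<in> eds W" "e \<in> eds D"
      by blast
    obtain u v where uv: "e = {u, v}" "(u, v) \<in> E" "u \<in> W" "v \<in> W"
      using e(1) by (auto simp: eds_def)
    have "e \<subseteq> D"
      using e(2) by (auto simp: eds_def)
    then have "u = a" "v = a"
      using uv DW by auto
    then show False
      using uv(2) E_irrefl by blast
  qed
  ultimately have "card (eds (W \<union> D)) = card (eds W) + card D"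
    using finW finD us card_eds_cyc_list card_cyc_list by (simp add: card_Un_disjoint finite_eds)
  moreover have "card (W \<union> D) + 1 = card W + card D"
    using card_Un_Int[OF finW finD] DW by (simp add: Int_commute)
  ultimately show ?thesis
    by (simp add: cyc_num_def)
qed

text \<open>A closed subset of \<open>W\<close> becomes closed in \<open>W \<union> D\<close> after
  adding \<open>D\<close> if it contains \<open>a\<close>, and unchanged otherwise.\<close>

lemma conn_attach:
  assumes "conn (W \<union> D)"
  shows "conn W"
  unfolding conn_def
proof (intro conjI allI impI)
  show "W \<noteq> {}"
    using attach_point_in by blast
next
  fix A assume A: "adj_closed W A" "A \<noteq> {}"
  have AW: "A \<subseteq> W"
    using A(1) by (simp add: adj_closed_def)
  have closed: "v \<in> A" if "u \<in> A" "v \<in> W" "(u, v) \<in> E" for u v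
    using A(1) that unfolding adj_closed_def by blast
  show "A = W"
  proof (cases "a \<in> A")
    case True
    have "adj_closed (W \<union> D) (A \<union> D)"
      unfolding adj_closed_def
    proof (intro conjI ballI impI)
      fix u v assume u: "u \<in> A \<union> D" and v: "v \<in> W \<union> D" and uv: "(u, v) \<in> E"
      show "v \<in> A \<union> D"
      proof (cases "v \<in> D")
        case False
        then have vW: "v \<in> W - {a}"
          using v attach_point_in by blast
        then have "u \<notin> D - {a}"
          using cross[of u v] uv by blast
        then have "u \<in> A"
          using u True by blast
        then show ?thesis
          using closed[OF _ _ uv] vW by blast
      qed simp
    qed (use AW in blast)
    then have AD: "A \<union> D = W \<union> D"
      using connD[OF assms] True by blast
    show ?thesis
    proof (intro equalityI subsetI)
      fix v assume "v \<in> W"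
      then have "v \<in> A \<or> v \<in> D \<inter> W"
        using AD by blast
      then show "v \<in> A"
        using DW True by auto
    qed (use AW in blast)
  next
    case False
    have "adj_closed (W \<union> D) A"
      unfolding adj_closed_def
    proof (intro conjI ballI impI)
      fix u v assume u: "u \<in> A" and v: "v \<in> W \<union> D" and uv: "(u, v) \<in> E"
      have "u \<in> W - {a}"
        using u AW False by blast
      then have "v \<notin> D - {a}"
        using cross[of v u] E_sym[OF uv] by blast
      then have "v \<in> W"
        using v attach_point_in by blast
      then show "v \<in> A"
        using closed[OF u _ uv] by blast
    qed (use AW in blast)
    then have "A = W \<union> D"
      using connD[OF assms] A(2) by blast
    then show ?thesis
      using False attach_point_in by blast
  qed
qed

text \<open>Two of the three neighbours of \<open>a\<close> lie on the cycle, so one remains in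
  \<open>W\<close>; all other degrees in \<open>W\<close> are unaffected.\<close>

lemma pend_attach:
  assumes "card (nb (W \<union> D) a) = 3"
  shows "pend W = insert a (pend (W \<union> D))" "a \<notin> pend (W \<union> D)"
proof -
  obtain us where us: "cyc_list D us"
    using tD type1_def by blast
  have deg2: "card (nb D v) = 2" if "v \<in> D" for v
    using card_nb_cyc_list[OF us refl that] .
  have "card (nb (W \<union> D) a) = card (nb W a) + card (nb D a)"
    unfolding nb_attach_point(1) using finite_attach nb_attach_point(2)
    by (intro card_Un_disjoint) (auto simp: finite_nb)
  then have "card (nb W a) = 1"
    using assms deg2 attach_point_in by simp
  moreover have "card (nb (W \<union> D) v) = 2" if "v \<in> D - {a}" for v
    using nb_attach_cycle[OF that] deg2 that by simp
  ultimately show "pend W = insert a (pend (W \<union> D))"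
    using nb_attach_base attach_point_in by (fastforce simp: pend_def)
  show "a \<notin> pend (W \<union> D)"
    using assms by (simp add: pend_def)
qed

lemma null_vec_attach_eqs:
  assumes us: "cyc_list D us" "us ! 0 = a" "m = length us" and k: "0 < k" "k < m" and z: "null_vec (W \<union> D) z"
  shows "(\<Sum>i\<in>nb D (us ! k). z i * \<phi> i (us ! k)) = 0"
proof -
  have "us ! k \<in> D - {a}"
    using cyc_list_nth_attach[OF us k] .
  then show ?thesis
    using z nb_attach_cycle[of "us ! k"] unfolding null_vec_def by (metis Diff_iff UnCI)
qed

text \<open>The two cycle neighbours of \<open>a\<close> contribute opposite terms to the equation at \<open>a\<close>.\<close>

lemma attach_point_sum:
  assumes us: "cyc_list D us" "m = length us" "even m" "cyc_gain \<phi> us = (-1) ^ (m div 2)" "us ! 0 = a"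
    and z: "z (us ! 1) = t * pgain us 1" "z (us ! (m - 1)) = t * pgain us (m - 1)"
  shows "(\<Sum>i\<in>nb D a. z i * \<phi> i a) = 0"
proof -
  have "pgain us 1 * \<phi> (us ! 1) a = 1"
    using pgain_1[OF us(1,2)] gain_mult[OF cyc_list_adj[OF us(1,2), of 0]] cyc_list_length[OF us(1,2)] us(5) by simp
  moreover have "pgain us (m - 1) * \<phi> (us ! (m - 1)) a = -1"
    using pgain_penultimate[OF us(1,2,3,4)] us(5) by simp
  ultimately show ?thesis
    using nb_cyc_list_0[OF us(1,2)] us(5) z by (simp add: mult.assoc)
qed

text \<open>Only the equation at \<open>a\<close> is in doubt. The odd positions lead from one cycle
  neighbour of \<open>a\<close> to the other, so both carry the same factor \<open>t\<close> and
  their terms in this equation cancel.\<close>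

lemma null_vec_restrict:
  assumes us: "cyc_list D us" "m = length us" "even m" "cyc_gain \<phi> us = (-1) ^ (m div 2)" "us ! 0 = a"
    and z: "null_vec (W \<union> D) z"
  shows "null_vec W z"
  unfolding null_vec_def
proof
  fix j assume j: "j \<in> W"
  show "(\<Sum>i\<in>nb W j. z i * \<phi> i j) = 0"
  proof (cases "j = a")
    case True
    define t where "t = z (us ! 1) * inverse (pgain us 1)"
    have "pgain us 1 \<noteq> 0"
      using pgain_1[OF us(1,2)] gain_nonzero[OF cyc_list_adj[OF us(1,2), of 0]] cyc_list_length[OF us(1,2)] by simp
    then have t: "z (us ! 1) = t * pgain us 1"
      by (simp add: t_def mult.assoc)
    \<comment> \<open>With this \<open>h\<close>, the chain from position 1 ends at
      \<open>1 + 2 * h = m - 1\<close>.\<close>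
    obtain h where h: "m = 2 * Suc h"
      using us(3) cyc_list_length[OF us(1,2)] by (metis evenE not0_implies_Suc mult_0_right not_numeral_le_zero)
    have "z (us ! ((1 + 2 * h) mod m)) = t * pgain us (1 + 2 * h)"
      using null_chain[OF us(1,2) null_vec_attach_eqs[OF us(1,5,2) _ _ z] t, of h] h by simp
    then have "z (us ! (m - 1)) = t * pgain us (m - 1)"
      using h by simp
    then have "(\<Sum>i\<in>nb D a. z i * \<phi> i a) = 0"
      using attach_point_sum[OF us] t by simp
    moreover have "(\<Sum>i\<in>nb (W \<union> D) a. z i * \<phi> i a) = 0"
      using z attach_point_in unfolding null_vec_def by blast
    ultimately show ?thesis
      using sum_attach_point[of "\<lambda>i. z i * \<phi> i a"] True by simp
  next
    case False
    then show ?thesis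
      using z j nb_attach_base[of j] unfolding null_vec_def by (metis DiffI UnI1 singletonD)
  qed
qed

text \<open>The even positions are forced by the value at \<open>a\<close>, the odd ones carry a
  free parameter \<open>t\<close>. This one extra parameter is the reason why attaching the cycle
  raises the nullity by exactly one.\<close>

lemma null_vec_extend:
  assumes us: "cyc_list D us" "m = length us" "even m" "cyc_gain \<phi> us = (-1) ^ (m div 2)" "us ! 0 = a"
    and z: "null_vec W z"
  obtains z' where "null_vec (W \<union> D) z'" "\<And>v. v \<in> W \<Longrightarrow> z' v = z v"
    "\<And>k. k < m \<Longrightarrow> z' (us ! k) = (if even k then z a else t) * pgain us k"
proof -
  have cyc_list_length': "3 \<le> m"
    using cyc_list_length[OF us(1,2)] .
  \<comment> \<open>\<open>LEAST\<close> recovers the position of \<open>v\<close> on the cycle: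
    positions are unique below \<open>m\<close>, and the unspecified entries beyond the end of the
    list have larger indices.\<close>
  define z' where "z' v = (if v \<in> W then z v else
    (let k = (LEAST k. us ! k = v) in (if even k then z a else t) * pgain us k))" for v
  have idx: "(LEAST j. us ! j = us ! k) = k" if "k < m" for k
  proof (rule Least_equality)
    show "k \<le> j" if "us ! j = us ! k" for j
      using cyc_list_nth_eq_iff[OF us(1,2) _ \<open>k < m\<close>, of j] that \<open>k < m\<close> by (cases "j < m") auto
  qed simp
  have val: "z' (us ! k) = (if even k then z a else t) * pgain us k" if "k < m" for k
  proof (cases "k = 0")
    case True
    then show ?thesis
      using us(5) attach_point_in pgain_0[OF us(1,2)] by (simp add: z'_def)
  next
    case False
    then have "us ! k \<in> D - {a}"
      using cyc_list_nth_attach[OF us(1,5,2)] that by blast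
    then have "us ! k \<notin> W"
      using DW by blast
    then show ?thesis
      using idx[OF that] by (simp add: z'_def)
  qed
  \<comment> \<open>The formula extends to \<open>k = m\<close>, where the vertex is
    \<open>a\<close> again; this is consistent because the Type 1 condition means
    \<open>pgain us m = 1\<close>.\<close>
  have val': "z' (us ! (k mod m)) = (if even k then z a else t) * pgain us k" if "k \<le> m" for k
  proof (cases "k = m")
    case True
    have "pgain us m = 1"
      using pgain_last[OF us(1,2,3)] us(4) by (simp add: sign_square)
    then show ?thesis
      using val[of 0] True us(3) cyc_list_length' pgain_0[OF us(1,2)] by simp
  qed (use val that in simp)
  have onW: "z' v = z v" if "v \<in> W" for v
    using that by (simp add: z'_def)
  have "null_vec (W \<union> D) z'"
    unfolding null_vec_def
  proof
    fix j assume "j \<in> W \<union> D"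
    then consider "j \<in> W - {a}" | "j = a" | "j \<in> D - {a}"
      by blast
    then show "(\<Sum>i\<in>nb (W \<union> D) j. z' i * \<phi> i j) = 0"
    proof cases
      case 1
      have "(\<Sum>i\<in>nb W j. z' i * \<phi> i j) = (\<Sum>i\<in>nb W j. z i * \<phi> i j)"
        using onW nb_subset by (intro sum.cong) auto
      then show ?thesis
        using z nb_attach_base[OF 1] 1 unfolding null_vec_def by auto
    next
      case 2
      have "(\<Sum>i\<in>nb W j. z' i * \<phi> i j) = (\<Sum>i\<in>nb W j. z i * \<phi> i j)"
        using onW nb_subset by (intro sum.cong) auto
      then have "(\<Sum>i\<in>nb W a. z' i * \<phi> i a) = 0"
        using z attach_point_in 2 unfolding null_vec_def by auto
      moreover have "(\<Sum>i\<in>nb D a. z' i * \<phi> i a) = 0"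
        using attach_point_sum[OF us, of z' t] val[of 1] val[of "m - 1"] cyc_list_length' us(3) by simp
      ultimately show ?thesis
        using sum_attach_point[of "\<lambda>i. z' i * \<phi> i a"] 2 by simp
    next
      case 3
      then obtain k where k: "k < m" "j = us ! k" "0 < k"
        using us(5) by (auto simp: cyc_list_eq_image[OF us(1,2)] intro: gr0I)
      let ?t = "if even (k - 1) then z a else t"
      have "even (k - 1) \<longleftrightarrow> even (Suc k)"
        using k(3) by simp
      then have before: "z' (us ! (k - 1)) = ?t * pgain us (k - 1)"
        and after: "z' (us ! (Suc k mod m)) = ?t * pgain us (Suc k)"
        using val[of "k - 1"] val'[of "Suc k"] k by simp_all
      have "(\<Sum>i\<in>nb D (us ! k). z' i * \<phi> i (us ! k)) = 0"
        by (rule iffD2[OF null_eq_iff[where z = z' and t = ?t, OF us(1,2) k(3,1) before] after])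
      then show ?thesis
        using nb_attach_cycle[OF 3] k(2) by simp
    qed
  qed
  then show ?thesis
    using that[of z'] onW val by blast
qed

text \<open>For the upper bound, a determining set of \<open>W\<close> makes the restriction vanish,
  and position 1 then takes care of the odd positions. For the lower bound, a determining set of
  \<open>W \<union> D\<close> contains an odd cycle position; dropping it and moving the remaining
  cycle vertices to \<open>a\<close> leaves a determining set of \<open>W\<close>.\<close>

lemma nullity_attach: "nullity (W \<union> D) = nullity W + 1"
proof -
  obtain us where us': "cyc_list D us" "even (length us)"
    "cyc_gain \<phi> us = (-1) ^ (length us div 2)" "us ! 0 = a"
    using type1_based[OF tD attach_point_in(1)] by blast
  define m where "m = length us"
  have us: "cyc_list D us" "m = length us" "even m" "cyc_gain \<phi> us = (-1) ^ (m div 2)" "us ! 0 = a"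
    using us' by (simp_all add: m_def)
  have cyc_list_length': "3 \<le> m"
    using cyc_list_length[OF us(1,2)] .
  note D = cyc_list_eq_image[OF us(1,2)]
  have le: "nullity (W \<union> D) \<le> nullity W + 1"
  proof -
    obtain S where S: "determ W S" "card S = nullity W"
      using nullity_witness by blast
    have "determ (W \<union> D) (insert (us ! 1) S)"
      unfolding determ_def
    proof (intro conjI allI impI ballI)
      show "insert (us ! 1) S \<subseteq> W \<union> D"
        using S(1) cyc_list_length' by (auto simp: determ_def D)
    next
      fix z v assume z: "null_vec (W \<union> D) z" "\<forall>i\<in>insert (us ! 1) S. z i = 0" and v: "v \<in> W \<union> D"
      have zW: "\<forall>i\<in>W. z i = 0"
        using S(1) null_vec_restrict[OF us z(1)] z(2) unfolding determ_def by blast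
      show "z v = 0"
      proof (cases "v \<in> D")
        case True
        show ?thesis
          using null_zero_all[OF us(1,2) null_vec_attach_eqs[OF us(1,5,2) _ _ z(1)]] zW z(2) attach_point_in us(5) True
          by blast
      qed (use zW v in blast)
    qed
    from nullity_le[OF this] S(2) show ?thesis
      using card_insert_le_m1[of "Suc (nullity W)" S "us ! 1"] by simp
  qed
  have ge: "nullity W + 1 \<le> nullity (W \<union> D)"
  proof -
    obtain S where S: "determ (W \<union> D) S" "card S = nullity (W \<union> D)"
      using nullity_witness by blast
    have finS: "finite S"
      using S(1) finite_attach unfolding determ_def by (meson finite_subset)
    have pgain1: "pgain us 1 \<noteq> 0"
      using pgain_1[OF us(1,2)] gain_nonzero[OF cyc_list_adj[OF us(1,2), of 0]] cyc_list_length' by simp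
    obtain k\<^sub>0 where k0: "k\<^sub>0 < m" "odd k\<^sub>0" "us ! k\<^sub>0 \<in> S"
    proof -
      \<comment> \<open>Extending the zero vector with \<open>t = 1\<close> gives a nonzero null
        vector supported on the odd cycle positions, so \<open>S\<close> must meet them.\<close>
      have "null_vec W (\<lambda>_. 0)"
        by (simp add: null_vec_def)
      from null_vec_extend[OF us this, of 1] obtain e where e: "null_vec (W \<union> D) e"
        "\<And>v. v \<in> W \<Longrightarrow> e v = 0" "\<And>k. k < m \<Longrightarrow> e (us ! k) = (if even k then 0 else 1) * pgain us k"
        by metis
      have "e (us ! 1) \<noteq> 0"
        using e(3)[of 1] pgain1 cyc_list_length' by simp
      moreover have "us ! 1 \<in> W \<union> D"
        using cyc_list_length' by (auto simp: D)
      ultimately obtain v where v: "v \<in> S" "e v \<noteq> 0"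
        using S(1) e(1) unfolding determ_def by blast
      then have "v \<in> D"
        using e(2) S(1) unfolding determ_def by blast
      then obtain k where "k < m" "v = us ! k"
        by (auto simp: D)
      then show ?thesis
        using that[of k] v e(3)[of k] by (auto split: if_splits)
    qed
    \<comment> \<open>For extensions with parameter 0, vanishing at \<open>a\<close> already implies
      vanishing on the whole cycle, so \<open>a\<close> can stand in for any cycle vertex of
      \<open>S\<close> outside \<open>W\<close>.\<close>
    define f where "f v = (if v \<in> W then v else a)" for v
    let ?S = "f ` (S - {us ! k\<^sub>0})"
    have "determ W ?S"
      unfolding determ_def
    proof (intro conjI allI impI)
      show "?S \<subseteq> W"
        using attach_point_in by (auto simp: f_def)
    next
      fix z assume z: "null_vec W z" "\<forall>i\<in>?S. z i = 0"
      obtain z' where z': "null_vec (W \<union> D) z'" "\<And>v. v \<in> W \<Longrightarrow> z' v = z v"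
        "\<And>k. k < m \<Longrightarrow> z' (us ! k) = (if even k then z a else 0) * pgain us k"
        using null_vec_extend[OF us z(1), of 0] by metis
      have "z' v = 0" if "v \<in> S" for v
      proof (cases "v = us ! k\<^sub>0")
        case True
        then show ?thesis
          using z'(3)[OF k0(1)] k0(2) by simp
      next
        case False
        then have fv: "z (f v) = 0"
          using z(2) that by blast
        show ?thesis
        proof (cases "v \<in> W")
          case True
          then show ?thesis
            using fv z'(2) by (simp add: f_def)
        next
          case False
          then have "z a = 0"
            using fv by (simp add: f_def)
          moreover have "v \<in> D"
            using S(1) that False unfolding determ_def by blast
          ultimately show ?thesis
            using z'(3) by (auto simp: D)
        qed
      qed
      then have "\<forall>v\<in>W \<union> D. z' v = 0"
        using S(1) z'(1) unfolding determ_def by blast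
      then show "\<forall>i\<in>W. z i = 0"
        using z'(2) by auto
    qed
    from nullity_le[OF this] have "nullity W \<le> card (S - {us ! k\<^sub>0})"
      using card_image_le[of "S - {us ! k\<^sub>0}" f] finS by simp
    then show ?thesis
      using S(2) k0(3) finS card_Suc_Diff1[of S "us ! k\<^sub>0"] by simp
  qed
  show ?thesis
    using le ge by simp
qed

end

subsection \<open>Cycles in graphs without leaves\<close>

definition cyc_in :: "'a set \<Rightarrow> 'a list \<Rightarrow> bool" where
  "cyc_in W us \<longleftrightarrow> 3 \<le> length us \<and> distinct us \<and> set us \<subseteq> W \<and> set (cyc_pairs us) \<subseteq> E"

lemma cyc_in_iff:
  "cyc_in W us \<longleftrightarrow> 3 \<le> length us \<and> distinct us \<and> set us \<subseteq> W
    \<and> (\<forall>k<length us. (us ! k, us ! (Suc k mod length us)) \<in> E)"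
  by (auto simp: cyc_in_def set_cyc_pairs)

lemma cyc_in_rotate: "cyc_in W us \<Longrightarrow> cyc_in W (rotate n us)"
  by (induction n) (simp_all add: cyc_in_def cyc_pairs_rotate1)

text \<open>All neighbours of the first vertex of a longest path lie on the path, and one of them,
  different from the second vertex, closes a cycle.\<close>

lemma cyc_in_exists:
  assumes fin: "finite W" and ne: "W \<noteq> {}" and deg: "\<And>v. v \<in> W \<Longrightarrow> 2 \<le> card (nb W v)"
  shows "\<exists>us. cyc_in W us"
proof -
  define P where "P ps \<longleftrightarrow> distinct ps \<and> set ps \<subseteq> W \<and> ps \<noteq> []
    \<and> (\<forall>k. Suc k < length ps \<longrightarrow> (ps ! k, ps ! Suc k) \<in> E)" for ps
  obtain w where "w \<in> W"
    using ne by blast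
  then have "P [w]"
    by (simp add: P_def)
  moreover have "\<forall>ps. P ps \<longrightarrow> length ps < Suc (card W)"
    using fin card_mono distinct_card unfolding P_def by (metis less_Suc_eq_le)
  ultimately obtain ps where ps: "P ps" and longest: "\<And>qs. P qs \<Longrightarrow> length qs \<le> length ps"
    using ex_has_greatest_nat[of P "[w]" length] by blast
  have E: "(ps ! k, ps ! Suc k) \<in> E" if "Suc k < length ps" for k
    using ps that by (simp add: P_def)
  have nb_ps: "nb W (ps ! 0) \<subseteq> set ps"
  proof
    fix u assume u: "u \<in> nb W (ps ! 0)"
    show "u \<in> set ps"
    proof (rule ccontr)
      assume "u \<notin> set ps"
      moreover have "((u # ps) ! k, (u # ps) ! Suc k) \<in> E" if "Suc k < length (u # ps)" for k
        using that u E by (cases k) (auto simp: nb_def)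
      ultimately have "P (u # ps)"
        using ps u by (auto simp: P_def nb_def)
      then show False
        using longest by fastforce
    qed
  qed
  have "ps ! 0 \<in> W"
    using ps unfolding P_def by (metis length_greater_0_conv nth_mem subsetD)
  have "\<exists>u\<in>nb W (ps ! 0). u \<noteq> ps ! 1"
  proof (rule ccontr)
    assume "\<not> ?thesis"
    then have "nb W (ps ! 0) \<subseteq> {ps ! 1}"
      by blast
    then have "card (nb W (ps ! 0)) \<le> 1"
      using card_mono[of "{ps ! 1}"] by simp
    then show False
      using deg[OF \<open>ps ! 0 \<in> W\<close>] by linarith
  qed
  then obtain j where j: "j < length ps" "ps ! j \<in> nb W (ps ! 0)" "ps ! j \<noteq> ps ! 1"
    using nb_ps by (metis in_set_conv_nth subsetD)
  have "j \<noteq> 0" "j \<noteq> 1"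
    using j E_irrefl by (auto simp: nb_def intro: gr0I)
  then have "2 \<le> j"
    by linarith
  have "cyc_in W (take (Suc j) ps)"
    unfolding cyc_in_iff
  proof (intro conjI allI impI)
    show "3 \<le> length (take (Suc j) ps)"
      using \<open>2 \<le> j\<close> j(1) by simp
    show "distinct (take (Suc j) ps)" "set (take (Suc j) ps) \<subseteq> W"
      using ps set_take_subset by (auto simp: P_def dest: in_set_takeD)
  next
    fix k assume k: "k < length (take (Suc j) ps)"
    have len: "length (take (Suc j) ps) = Suc j"
      using j(1) by simp
    show "(take (Suc j) ps ! k, take (Suc j) ps ! (Suc k mod length (take (Suc j) ps))) \<in> E"
    proof (cases "k = j")
      case True
      then show ?thesis
        using len j(2) by (simp add: nb_def)
    next
      case False
      then show ?thesis
        using len k j(1) E[of k] by simp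
    qed
  qed
  then show ?thesis
    by blast
qed

text \<open>The rest of the cycle is a path avoiding \<open>us ! 0\<close>, so it stays in one
  component, which then contains both cycle neighbours of \<open>us ! 0\<close>.\<close>

lemma comp_of_cycle:
  assumes us: "cyc_in W us" and fin: "finite W"
  shows "\<exists>C\<in>comps (W - {us ! 0}). us ! 1 \<in> nb C (us ! 0) \<and> 2 \<le> card (nb C (us ! 0))"
proof -
  define m where "m = length us"
  have m: "3 \<le> m" and dist: "distinct us" and E: "\<And>k. k < m \<Longrightarrow> (us ! k, us ! (Suc k mod m)) \<in> E"
    using us by (auto simp: cyc_in_iff m_def)
  have in_W: "us ! k \<in> W - {us ! 0}" if "0 < k" "k < m" for k
    using us that dist nth_eq_iff_index_eq[of us k 0] m unfolding cyc_in_def m_def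
    by (metis Diff_iff One_nat_def less_numeral_extra(3) less_trans nth_mem singletonD subsetD)
  have "us ! 1 \<in> W - {us ! 0}"
    using in_W[of 1] m by simp
  then obtain C where C: "C \<in> comps (W - {us ! 0})" "us ! 1 \<in> C"
    using comps_cover[of "W - {us ! 0}"] by (metis UnionE)
  have C_nth: "Suc k < m \<Longrightarrow> us ! Suc k \<in> C" for k
  proof (induction k)
    case 0
    then show ?case using C(2) by simp
  next
    case (Suc k)
    then have "(us ! Suc k, us ! Suc (Suc k)) \<in> E"
      using E[of "Suc k"] by simp
    then show ?case
      using compsD(4)[OF C(1), of "us ! Suc k" "us ! Suc (Suc k)"] Suc in_W[of "Suc (Suc k)"] by simp
  qed
  have "us ! 1 \<in> nb C (us ! 0)"
    using C(2) E_sym[OF E[of 0]] m by (simp add: nb_def)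
  moreover have "us ! (m - 1) \<in> nb C (us ! 0)"
    using C_nth[of "m - 2"] E[of "m - 1"] m by (simp add: nb_def numeral_2_eq_2 Suc_diff_Suc)
  moreover have "us ! 1 \<noteq> us ! (m - 1)"
    using dist m by (simp add: nth_eq_iff_index_eq m_def)
  moreover have "finite (nb C (us ! 0))"
    using compsD(1)[OF C(1)] fin by (meson finite_Diff finite_nb finite_subset)
  ultimately have "card {us ! 1, us ! (m - 1)} \<le> card (nb C (us ! 0))"
    by (intro card_mono) auto
  then show ?thesis
    using C(1) \<open>us ! 1 \<in> nb C (us ! 0)\<close> \<open>us ! 1 \<noteq> us ! (m - 1)\<close> by auto
qed

text \<open>The two cycle neighbours exhaust the neighbourhood of each vertex. Hence the cycle has
  no chord, no edge leaves it, and by connectedness it is all of \<open>W\<close>.\<close>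

lemma cyc_list_if_deg2:
  assumes "finite W" "conn W" and us: "cyc_in W us" and deg: "\<And>v. v \<in> set us \<Longrightarrow> card (nb W v) = 2"
  shows "cyc_list W us"
proof -
  define m where "m = length us"
  have m: "3 \<le> m" and dist: "distinct us" and sub: "set us \<subseteq> W"
    and E: "\<And>k. k < m \<Longrightarrow> (us ! k, us ! (Suc k mod m)) \<in> E"
    using us by (auto simp: cyc_in_iff m_def)
  have memW: "us ! k \<in> W" if "k < m" for k
    using sub that by (auto simp: m_def)
  have nb_us: "\<exists>j<m. nb W (us ! k) = {us ! j, us ! (Suc k mod m)} \<and> Suc j mod m = k" if k: "k < m" for k
  proof -
    define j where "j = (if k = 0 then m - 1 else k - 1)"
    have j: "j < m" "Suc j mod m = k" "j \<noteq> Suc k mod m" "Suc k mod m < m"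
      using k m by (auto simp: j_def mod_Suc)
    have "{us ! j, us ! (Suc k mod m)} \<subseteq> nb W (us ! k)"
      using E[OF j(1)] j E_sym[OF E[OF k]] memW by (simp add: nb_def)
    moreover have "us ! j \<noteq> us ! (Suc k mod m)"
      using dist j nth_eq_iff_index_eq unfolding m_def by blast
    moreover have "card (nb W (us ! k)) = 2"
      using deg k by (simp add: m_def)
    ultimately have "{us ! j, us ! (Suc k mod m)} = nb W (us ! k)"
      using finite_nb[OF assms(1)] by (intro card_subset_eq) auto
    then show ?thesis
      using j by metis
  qed
  have adj: "(us ! k, v) \<in> set (cyc_pairs us) \<union> (set (cyc_pairs us))\<inverse> \<and> v \<in> set us"
    if "k < m" "v \<in> W" "(us ! k, v) \<in> E" for k v
  proof -
    have "v \<in> nb W (us ! k)"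
      using that E_sym by (simp add: nb_def)
    with nb_us[OF \<open>k < m\<close>] consider j where "j < m" "v = us ! j" "Suc j mod m = k" | "v = us ! (Suc k mod m)"
      by blast
    then show ?thesis
    proof cases
      case 1
      then have "(v, us ! k) \<in> set (cyc_pairs us)"
        by (auto simp: set_cyc_pairs m_def)
      then show ?thesis
        using 1 by (auto simp: m_def)
    next
      case 2
      then have "(us ! k, v) \<in> set (cyc_pairs us)"
        using that by (auto simp: set_cyc_pairs m_def)
      moreover have "Suc k mod m < m"
        using m by simp
      ultimately show ?thesis
        using 2 nth_mem[of "Suc k mod m" us] by (simp add: m_def)
    qed
  qed
  have "adj_closed W (set us)"
    unfolding adj_closed_def
  proof (intro conjI ballI impI)
    fix u v assume "u \<in> set us" "v \<in> W" "(u, v) \<in> E"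
    then show "v \<in> set us"
      using adj unfolding m_def by (metis in_set_conv_nth)
  qed (rule sub)
  moreover have "set us \<noteq> {}"
    using m by (auto simp: m_def)
  ultimately have W: "set us = W"
    using connD[OF assms(2)] by blast
  have pairs_W: "set (cyc_pairs us) \<subseteq> W \<times> W"
  proof -
    have "Suc k mod m < m" for k
      using m by simp
    then show ?thesis
      using memW by (auto simp: set_cyc_pairs m_def[symmetric])
  qed
  have "E \<inter> W \<times> W = set (cyc_pairs us) \<union> (set (cyc_pairs us))\<inverse>"
  proof (intro equalityI subsetI)
    fix p assume "p \<in> E \<inter> W \<times> W"
    then obtain u v where p: "p = (u, v)" "(u, v) \<in> E" "u \<in> W" "v \<in> W"
      by blast
    then obtain k where "k < m" "u = us ! k"
      using W by (metis in_set_conv_nth m_def)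
    then show "p \<in> set (cyc_pairs us) \<union> (set (cyc_pairs us))\<inverse>"
      using adj p by blast
  next
    fix p assume "p \<in> set (cyc_pairs us) \<union> (set (cyc_pairs us))\<inverse>"
    moreover have "set (cyc_pairs us) \<subseteq> E"
      using us by (simp add: cyc_in_def)
    ultimately show "p \<in> E \<inter> W \<times> W"
      using pairs_W E_sym by blast
  qed
  then show ?thesis
    using m dist W by (simp add: cyc_list_def m_def)
qed

text \<open>Deleting \<open>x\<close> does not turn its neighbour \<open>w\<close> into a leaf.\<close>

lemma leafless_cases:
  assumes fin: "finite W" and con: "conn W" and deg: "\<And>v. v \<in> W \<Longrightarrow> 2 \<le> card (nb W v)"
  obtains us where "cyc_list W us"
  | x w C where "x \<in> W" "C \<in> comps (W - {x})" "w \<in> nb C x" "3 \<le> card (nb W w)" "2 \<le> card (nb C x)"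
proof -
  obtain us where us: "cyc_in W us"
    using cyc_in_exists[OF fin conn_nonempty[OF con] deg] by blast
  show ?thesis
  proof (cases "\<forall>v\<in>set us. card (nb W v) = 2")
    case True
    then show ?thesis
      using that(1) cyc_list_if_deg2[OF fin con us] by blast
  next
    case False
    then obtain i where i: "i < length us" "card (nb W (us ! i)) \<noteq> 2"
      by (metis in_set_conv_nth)
    \<comment> \<open>This rotation brings \<open>us ! i\<close> to position 1 and its predecessor,
      the vertex to be deleted, to position 0. The added length keeps the subtraction exact for
      \<open>i = 0\<close>.\<close>
    define vs where "vs = rotate (i + length us - 1) us"
    have vs: "cyc_in W vs"
      unfolding vs_def using us by (rule cyc_in_rotate)
    have "1 < length us"
      using us by (simp add: cyc_in_def)
    then have "vs ! 1 = us ! ((i + length us - 1 + 1) mod length us)"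
      unfolding vs_def by (rule nth_rotate)
    also have "(i + length us - 1 + 1) mod length us = i"
  proof -
      have "i + length us - 1 + 1 = i + length us"
        using i(1) by linarith
      then show ?thesis
        using i(1) by simp
    qed
    finally have vs1: "vs ! 1 = us ! i" .
    obtain C where C: "C \<in> comps (W - {vs ! 0})" "vs ! 1 \<in> nb C (vs ! 0)" "2 \<le> card (nb C (vs ! 0))"
      using comp_of_cycle[OF vs fin] by blast
    have "us ! i \<in> W"
      using us i(1) by (auto simp: cyc_in_def)
    then have "3 \<le> card (nb W (vs ! 1))"
      using deg[of "us ! i"] i(2) vs1 by simp
    moreover have "vs ! 0 \<in> W"
      using vs by (auto simp: cyc_in_def subset_iff)
        (metis gr_zeroI less_nat_zero_code list.size(3) nth_mem numeral_3_eq_3 le_zero_eq nat.distinct(1))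
    ultimately show ?thesis
      using that(2)[of "vs ! 0" C "vs ! 1"] C by blast
  qed
qed

lemma no_cyc_in_if_cyc_num_zero:
  assumes "finite W" "conn W" "cyc_num W = 0"
  shows "\<not> cyc_in W us"
proof
  assume us: "cyc_in W us"
  obtain C where C: "C \<in> comps (W - {us ! 0})" "2 \<le> card (nb C (us ! 0))"
    using comp_of_cycle[OF us assms(1)] by blast
  have "0 < length us" "set us \<subseteq> W"
    using us by (auto simp: cyc_in_def)
  then have "us ! 0 \<in> W"
    using nth_mem by blast
  then have "1 \<le> cyc_num W"
    using cyc_num_pos[OF assms(1,2) _ C] by blast
  then show False
    using assms(3) by simp
qed

subsection \<open>The nullity bound and its extremal graphs\<close>

text \<open>With the rank equal to the order minus the nullity, this is the rank condition of the
  theorem for the graph when \<open>pend W\<close> is empty, and for the tree when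
  \<open>cyc_num W = 0\<close>.\<close>

definition tight :: "'a set \<Rightarrow> bool" where
  "tight W \<longleftrightarrow> int (nullity W) = 2 * cyc_num W + int (card (pend W)) - 1"

text \<open>Every vertex of \<open>D\<close> has two neighbours on the cycle already, so the degrees
  say that a single edge leaves \<open>D\<close>, and that it leaves at \<open>a\<close>.\<close>

definition end_cycle :: "'a set \<Rightarrow> 'a set \<Rightarrow> 'a \<Rightarrow> bool" where
  "end_cycle W D a \<longleftrightarrow> type1 D \<and> D \<subseteq> W \<and> a \<in> D \<and> card (nb W a) = 3
     \<and> (\<forall>v\<in>D - {a}. card (nb W v) = 2)"

lemma pend_subset: "pend W \<subseteq> W"
  by (auto simp: pend_def)

lemma type1_facts:
  assumes "type1 D"
  shows "finite D" "cyc_num D = 1" "nullity D \<le> 2" "\<And>v. v \<in> D \<Longrightarrow> card (nb D v) = 2"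
  using assms finite_cyc_list cyc_num_cyc_list nullity_cyc_list_le_2 card_nb_cyc_list unfolding type1_def by metis+

lemma cyc_num_singleton: "cyc_num {v} = 0"
proof -
  have "eds {v} = {}"
    using E_irrefl by (auto simp: eds_def)
  then show ?thesis
    by (simp add: cyc_num_def)
qed

lemma comp_finite: "finite W \<Longrightarrow> C \<in> comps (W - {x}) \<Longrightarrow> finite C"
  using compsD(1) finite_subset finite_Diff by metis

lemma comp_singleton:
  assumes "finite W" "conn W" "x \<in> W" "C \<in> comps (W - {x})" "card C = 1"
  obtains v where "C = {v}" "v \<in> pend W" "nb C x = {v}"
proof -
  obtain v where v: "C = {v}"
    using assms(5) card_1_singletonE by blast
  have nbx: "nb C x = {v}"
    using comp_nb_nonempty[OF assms(2-4)] nb_subset[of C x] v by blast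
  moreover have "nb C v = {}"
    using v E_irrefl by (auto simp: nb_def)
  ultimately have "card (nb W v) = 1"
    using card_nb_del[OF assms(1,3,4), of v] v by simp
  then have "v \<in> pend W"
    using compsD(1)[OF assms(4)] v by (auto simp: pend_def)
  then show ?thesis
    using that v nbx by blast
qed

lemma pend_comp:
  assumes "finite W" "x \<in> W" "C \<in> comps (W - {x})"
  shows "pend C \<subseteq> (pend W \<inter> C) \<union> (nb C x \<inter> pend C)"
  using card_nb_del[OF assms] compsD(1)[OF assms(3)] by (auto simp: pend_def)

lemma card_pend_comp:
  assumes "finite W" "x \<in> W" "C \<in> comps (W - {x})"
  shows "card (pend C) \<le> card (pend W \<inter> C) + card (nb C x \<inter> pend C)"
proof -
  have "finite C"
    using comp_finite assms by blast
  then have "card (pend C) \<le> card ((pend W \<inter> C) \<union> (nb C x \<inter> pend C))"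
    using pend_comp[OF assms] by (intro card_mono) (auto simp: finite_nb)
  also have "\<dots> \<le> card (pend W \<inter> C) + card (nb C x \<inter> pend C)"
    by (rule card_Un_le)
  finally show ?thesis .
qed

text \<open>\<open>B\<close> is the share of \<open>C\<close> in
  \<open>2 * cyc_num W + card (pend W)\<close>. Let d be the number of edges between
  \<open>x\<close> and \<open>C\<close>. A leaf of \<open>C\<close> is a leaf of \<open>W\<close> or
  one of the d neighbours of \<open>x\<close>, so in the generic case the bound for \<open>C\<close>
  stays below \<open>B\<close> by at least d - 1. Equality thus needs d = 1 and the neighbour of
  \<open>x\<close> to be a leaf of \<open>C\<close>. Single vertices and Type 1 cycles, which escape
  the bound, are compared with \<open>B\<close> directly.\<close>

lemma comp_bound:
  assumes fin: "finite W" and con: "conn W" and x: "x \<in> W" and C: "C \<in> comps (W - {x})"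
    and hyp: "2 \<le> card C \<Longrightarrow> type1 C \<or> int (nullity C) \<le> 2 * cyc_num C + int (card (pend C)) - 1"
  defines "B \<equiv> 2 * (cyc_num C + (int (card (nb C x)) - 1)) + int (card (pend W \<inter> C))"
  shows "int (nullity C) \<le> B"
    and "int (nullity C) = B \<Longrightarrow> card (nb C x) = 1 \<and> (card C = 1 \<or> type1 C \<or> (tight C \<and> nb C x \<subseteq> pend C))"
proof -
  have B: "B = 2 * cyc_num C + 2 * int (card (nb C x)) - 2 + int (card (pend W \<inter> C))"
    by (simp add: B_def algebra_simps)
  have finC: "finite C"
    using comp_finite fin C by blast
  have d: "1 \<le> card (nb C x)"
    using comp_nb_pos[OF fin con x C] .
  have "1 \<le> card C"
    using compsD(3)[OF C] finC by (simp add: Suc_leI card_gt_0_iff)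
  then consider "card C = 1" | "2 \<le> card C" "type1 C"
    | "2 \<le> card C" "int (nullity C) \<le> 2 * cyc_num C + int (card (pend C)) - 1"
    using hyp by linarith
  then have "int (nullity C) \<le> B \<and> (int (nullity C) = B \<longrightarrow>
    card (nb C x) = 1 \<and> (card C = 1 \<or> type1 C \<or> (tight C \<and> nb C x \<subseteq> pend C)))"
  proof cases
    case 1
    obtain v where v: "C = {v}" "v \<in> pend W" "nb C x = {v}"
      using comp_singleton[OF fin con x C 1] .
    then have "pend W \<inter> C = {v}"
      by blast
    then have "B = 1"
      unfolding B_def using v by (simp add: cyc_num_singleton)
    then show ?thesis
      using nullity_le_card[of C] v by simp
  next
    case 2
    then show ?thesis
      using type1_facts[OF 2(2)] d unfolding B_def by auto
  next
    case 3
    have p: "int (card (pend C)) \<le> int (card (pend W \<inter> C)) + int (card (nb C x \<inter> pend C))"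
      using card_pend_comp[OF fin x C] by linarith
    have "card (nb C x \<inter> pend C) \<le> card (nb C x)"
      using finC by (intro card_mono) (auto simp: finite_nb)
    then have q: "int (card (nb C x \<inter> pend C)) \<le> int (card (nb C x))" "1 \<le> int (card (nb C x))"
      using d by linarith+
    have le: "int (nullity C) \<le> B"
      using 3(2) p q unfolding B by linarith
    moreover have "card (nb C x) = 1 \<and> tight C \<and> nb C x \<subseteq> pend C" if eq: "int (nullity C) = B"
    proof -
      have "int (card (nb C x)) \<le> 1" "int (card (nb C x)) \<le> int (card (nb C x \<inter> pend C))"
        using eq[unfolded B] 3(2) p q by linarith+
      then have d1: "card (nb C x) = 1" and "card (nb C x \<inter> pend C) = card (nb C x)"
        using q by linarith+
      then have "nb C x \<inter> pend C = nb C x"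
        using finC by (intro card_subset_eq) (auto simp: finite_nb)
      moreover have "tight C"
        using eq[unfolded B] 3(2) p q unfolding tight_def by linarith
      ultimately show ?thesis
        using d1 by blast
    qed
    ultimately show ?thesis
      by blast
  qed
  then show "int (nullity C) \<le> B"
    and "int (nullity C) = B \<Longrightarrow> card (nb C x) = 1 \<and> (card C = 1 \<or> type1 C \<or> (tight C \<and> nb C x \<subseteq> pend C))"
    by blast+
qed

text \<open>The leaf \<open>y\<close> belongs to none of the remaining components, so the shares sum
  to at most the right-hand side; this is the source of the -1. Equality has to hold in every share
  separately.\<close>

lemma leaf_bound:
  assumes fin: "finite W" and con: "conn W" and y: "y \<in> W" "nb W y = {x}"
    and hyps: "\<forall>C\<in>comps (W - {x}). 2 \<le> card C \<longrightarrow>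
      type1 C \<or> int (nullity C) \<le> 2 * cyc_num C + int (card (pend C)) - 1"
  shows "int (nullity W) \<le> 2 * cyc_num W + int (card (pend W)) - 1" (is ?le)
    and "\<And>C. tight W \<Longrightarrow> C \<in> comps (W - {x}) \<Longrightarrow> C \<noteq> {y} \<Longrightarrow>
      card (nb C x) = 1 \<and> (card C = 1 \<or> type1 C \<or> (tight C \<and> nb C x \<subseteq> pend C))"
    and "cyc_num W = (\<Sum>C\<in>comps (W - {x}) - {{y}}. cyc_num C + (int (card (nb C x)) - 1))"
proof -
  let ?K = "comps (W - {x})"
  let ?L = "?K - {{y}}"
  let ?f = "\<lambda>C. cyc_num C + (int (card (nb C x)) - 1)"
  let ?B = "\<lambda>C. 2 * ?f C + int (card (pend W \<inter> C))"
  have hyp: "type1 C \<or> int (nullity C) \<le> 2 * cyc_num C + int (card (pend C)) - 1"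
    if "C \<in> comps (W - {x})" "2 \<le> card C" for C
    using hyps that by blast
  have x: "x \<in> W"
    using y(2) by (auto simp: nb_def)
  have finK: "finite ?K"
    using fin by (simp add: finite_comps)
  have yK: "{y} \<in> ?K"
    using leaf_comp y by blast
  have "nb {y} x = {y}"
    using comp_nb_nonempty[OF con x yK] nb_subset[of "{y}" x] by blast
  then have "?f {y} = 0"
    by (simp add: cyc_num_singleton)
  then have cycW: "cyc_num W = (\<Sum>C\<in>?L. ?f C)"
    unfolding cyc_num_del[OF fin x] using finK yK sum.remove[of ?K "{y}" ?f] by simp
  then show "cyc_num W = (\<Sum>C\<in>?L. ?f C)" .
  have bound: "int (nullity C) \<le> ?B C" if "C \<in> ?L" for C
    using comp_bound(1)[OF fin con x] hyp that by blast
  have "y \<in> pend W"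
    using y by (simp add: pend_def)
  have finp: "finite (pend W)"
    using fin pend_subset finite_subset by blast
  have "(\<Sum>C\<in>?L. card (pend W \<inter> C)) = card (\<Union>C\<in>?L. pend W \<inter> C)"
  proof (rule card_UN_disjoint[symmetric])
    show "\<forall>C\<in>?L. \<forall>D\<in>?L. C \<noteq> D \<longrightarrow> (pend W \<inter> C) \<inter> (pend W \<inter> D) = {}"
      using comps_disjoint by blast
  qed (use finK finp in auto)
  also have "\<dots> \<le> card (pend W - {y})"
  proof (rule card_mono)
    show "(\<Union>C\<in>?L. pend W \<inter> C) \<subseteq> pend W - {y}"
    proof -
      have "y \<notin> C" if "C \<in> ?L" for C
        using comps_disjoint[OF _ yK, of C] that by blast
      then show ?thesis
        by blast
    qed
  qed (use finp in simp)
  finally have pends: "(\<Sum>C\<in>?L. card (pend W \<inter> C)) + 1 \<le> card (pend W)"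
    using finp \<open>y \<in> pend W\<close> by (simp add: card_Diff_singleton)
      (metis One_nat_def Suc_leI add.commute card_gt_0_iff emptyE le_diff_conv2 plus_1_eq_Suc)
  have "int (nullity W) \<le> (\<Sum>C\<in>?L. int (nullity C))"
    using nullity_leaf[OF fin y] by (metis of_nat_le_iff of_nat_sum)
  also have le: "\<dots> \<le> (\<Sum>C\<in>?L. ?B C)"
    using bound by (rule sum_mono)
  also have sumB: "(\<Sum>C\<in>?L. ?B C) = 2 * cyc_num W + int (\<Sum>C\<in>?L. card (pend W \<inter> C))"
    unfolding cycW by (simp add: sum.distrib sum_distrib_left)
  finally show ?le
    using pends by linarith
  fix C assume t: "tight W" and C: "C \<in> ?K" "C \<noteq> {y}"
  have "(\<Sum>C\<in>?L. int (nullity C)) = (\<Sum>C\<in>?L. ?B C)"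
    using \<open>int (nullity W) \<le> (\<Sum>C\<in>?L. int (nullity C))\<close> le sumB pends t unfolding tight_def by linarith
  then have "int (nullity C) = ?B C"
    using sum_mono_inv[of "\<lambda>C. int (nullity C)" ?L ?B C] bound C finK by blast
  then show "card (nb C x) = 1 \<and> (card C = 1 \<or> type1 C \<or> (tight C \<and> nb C x \<subseteq> pend C))"
    using comp_bound(2)[OF fin con x C(1)] hyp[OF C(1)] by blast
qed

text \<open>Let d be the number of edges between \<open>x\<close> and \<open>C\<close>. As
  \<open>w\<close> keeps degree at least 2 in \<open>C\<close>, deleting \<open>x\<close> creates at
  most d - 1 leaves there. The bound for \<open>C\<close> is then below the share lowered by 2 by at
  least d - 2, which is nonnegative since \<open>x\<close> has two neighbours in
  \<open>C\<close>.\<close>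

lemma comp_bound_nonleaf:
  assumes fin: "finite W" and con: "conn W" and x: "x \<in> W" and C: "C \<in> comps (W - {x})"
    and noleaf: "pend W = {}" and w: "w \<in> nb C x" "3 \<le> card (nb W w)" and d: "2 \<le> card (nb C x)"
    and hyp: "2 \<le> card C \<Longrightarrow> type1 C \<or> int (nullity C) \<le> 2 * cyc_num C + int (card (pend C)) - 1"
  defines "B \<equiv> 2 * (cyc_num C + (int (card (nb C x)) - 1)) - 2"
  shows "int (nullity C) \<le> B"
    and "int (nullity C) = B \<Longrightarrow> card (nb C x) = 2 \<and> (type1 C \<or> (tight C \<and> card (pend C) = 1 \<and> pend C \<subseteq> nb C x - {w}))"
proof -
  have B: "B = 2 * cyc_num C + 2 * int (card (nb C x)) - 4"
    by (simp add: B_def algebra_simps)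
  have finC: "finite C"
    using comp_finite fin C by blast
  have wC: "w \<in> C"
    using w(1) nb_subset by blast
  have "card (nb W w) = card (nb C w) + 1"
    using card_nb_del[OF fin x C wC] w(1) by simp
  then have dw: "2 \<le> card (nb C w)"
    using w(2) by linarith
  also have "\<dots> \<le> card C"
    using finC nb_subset by (rule card_mono)
  finally have hyp': "type1 C \<or> int (nullity C) \<le> 2 * cyc_num C + int (card (pend C)) - 1"
    by (rule hyp)
  have "w \<notin> pend C"
    using dw by (simp add: pend_def)
  then have sub: "pend C \<subseteq> nb C x - {w}"
    using pend_comp[OF fin x C] noleaf by blast
  then have "card (pend C) \<le> card (nb C x - {w})"
    using finC by (intro card_mono) (auto simp: finite_nb)
  also have "\<dots> = card (nb C x) - 1"
    using w(1) finC by (simp add: finite_nb)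
  finally have p: "int (card (pend C)) + 1 \<le> int (card (nb C x))" "2 \<le> int (card (nb C x))"
    using d by linarith+
  from hyp' have "int (nullity C) \<le> B \<and> (int (nullity C) = B \<longrightarrow>
    card (nb C x) = 2 \<and> (type1 C \<or> (tight C \<and> card (pend C) = 1 \<and> pend C \<subseteq> nb C x - {w})))"
  proof
    assume "type1 C"
    then show ?thesis
      using type1_facts[of C] d unfolding B_def by auto
  next
    assume n: "int (nullity C) \<le> 2 * cyc_num C + int (card (pend C)) - 1"
    then have "int (nullity C) \<le> B"
      using p unfolding B by linarith
    moreover have "card (nb C x) = 2 \<and> tight C \<and> card (pend C) = 1" if eq: "int (nullity C) = B"
    proof -
      have "int (card (nb C x)) = 2 \<and> int (nullity C) = 2 * cyc_num C + int (card (pend C)) - 1 \<and> int (card (pend C)) = 1"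
        using eq[unfolded B] n p by linarith
      then show ?thesis
        by (simp add: tight_def)
    qed
    ultimately show ?thesis
      using sub by blast
  qed
  then show "int (nullity C) \<le> B"
    and "int (nullity C) = B \<Longrightarrow> card (nb C x) = 2 \<and> (type1 C \<or> (tight C \<and> card (pend C) = 1 \<and> pend C \<subseteq> nb C x - {w}))"
    by blast+
qed

text \<open>The shares sum to \<open>2 * cyc_num W - 2\<close>, because \<open>C1\<close> saves 2;
  adding 1 for the deleted vertex gives the bound.\<close>

lemma leafless_bound:
  assumes fin: "finite W" and con: "conn W" and noleaf: "pend W = {}"
    and x: "x \<in> W" and C1: "C1 \<in> comps (W - {x})" and w: "w \<in> nb C1 x" "3 \<le> card (nb W w)"
    and d: "2 \<le> card (nb C1 x)"
    and hyps: "\<forall>C\<in>comps (W - {x}). 2 \<le> card C \<longrightarrow>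
      type1 C \<or> int (nullity C) \<le> 2 * cyc_num C + int (card (pend C)) - 1"
  shows "int (nullity W) \<le> 2 * cyc_num W - 1" (is ?le)
    and "tight W \<Longrightarrow> card (nb C1 x) = 2 \<and> (type1 C1 \<or> (tight C1 \<and> card (pend C1) = 1 \<and> pend C1 \<subseteq> nb C1 x - {w}))"
    and "\<And>C. tight W \<Longrightarrow> C \<in> comps (W - {x}) \<Longrightarrow> C \<noteq> C1 \<Longrightarrow>
      card (nb C x) = 1 \<and> (type1 C \<or> (tight C \<and> nb C x \<subseteq> pend C))"
proof -
  let ?K = "comps (W - {x})"
  let ?f = "\<lambda>C. cyc_num C + (int (card (nb C x)) - 1)"
  let ?B = "\<lambda>C. 2 * ?f C - (if C = C1 then 2 else 0)"
  have hyp: "type1 C \<or> int (nullity C) \<le> 2 * cyc_num C + int (card (pend C)) - 1"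
    if "C \<in> comps (W - {x})" "2 \<le> card C" for C
    using hyps that by blast
  have finK: "finite ?K"
    using fin by (simp add: finite_comps)
  have bound: "int (nullity C) \<le> ?B C" if C: "C \<in> ?K" for C
    using comp_bound(1)[OF fin con x C hyp[OF C]] comp_bound_nonleaf(1)[OF fin con x C1 noleaf w d hyp[OF C1]]
      noleaf by simp
  have "int (nullity W) \<le> 1 + (\<Sum>C\<in>?K. int (nullity C))"
    using nullity_del[OF fin x] by (metis of_nat_1 of_nat_add of_nat_le_iff of_nat_sum)
  moreover have le: "(\<Sum>C\<in>?K. int (nullity C)) \<le> (\<Sum>C\<in>?K. ?B C)"
    using bound by (rule sum_mono)
  moreover have sumB: "(\<Sum>C\<in>?K. ?B C) = 2 * cyc_num W - 2"
    unfolding cyc_num_del[OF fin x] using finK C1 by (simp add: sum_subtractf sum_distrib_left)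
  ultimately show ?le
    by linarith
  have eq: "int (nullity C) = ?B C" if t: "tight W" and C: "C \<in> ?K" for C
  proof -
    have "(\<Sum>C\<in>?K. int (nullity C)) = (\<Sum>C\<in>?K. ?B C)"
      using \<open>int (nullity W) \<le> 1 + (\<Sum>C\<in>?K. int (nullity C))\<close> le sumB t noleaf
      unfolding tight_def by simp
    then show ?thesis
      using sum_mono_inv[of "\<lambda>C. int (nullity C)" ?K ?B C] bound C finK by blast
  qed
  show "card (nb C1 x) = 2 \<and> (type1 C1 \<or> (tight C1 \<and> card (pend C1) = 1 \<and> pend C1 \<subseteq> nb C1 x - {w}))"
    if "tight W"
    using comp_bound_nonleaf(2)[OF fin con x C1 noleaf w d hyp[OF C1]] eq[OF that C1] by simp
  fix C assume t: "tight W" and C: "C \<in> ?K" "C \<noteq> C1"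
  \<comment> \<open>A component with one vertex would be a leaf of \<open>W\<close>.\<close>
  have "card C \<noteq> 1"
  proof
    assume "card C = 1"
    from comp_singleton[OF fin con x C(1) this] show False
      using noleaf by (metis empty_iff)
  qed
  then show "card (nb C x) = 1 \<and> (type1 C \<or> (tight C \<and> nb C x \<subseteq> pend C))"
    using comp_bound(2)[OF fin con x C(1) hyp[OF C(1)]] eq[OF t C(1)] C(2) noleaf by simp
qed

lemma deg_ge_2_if_leafless:
  assumes "finite W" "conn W" "2 \<le> card W" "pend W = {}" "v \<in> W"
  shows "2 \<le> card (nb W v)"
proof -
  have "W \<noteq> {v}"
    using assms(3) by auto
  then have "card (nb W v) \<noteq> 0"
    using conn_nb_nonempty[OF assms(2,5)] assms(1) by (simp add: finite_nb)
  moreover have "card (nb W v) \<noteq> 1"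
    using assms(4,5) by (auto simp: pend_def)
  ultimately show ?thesis
    by linarith
qed

lemma pend_nb:
  assumes "y \<in> pend W"
  obtains x where "y \<in> W" "nb W y = {x}" "x \<in> W" "x \<noteq> y"
proof -
  obtain x where "nb W y = {x}"
    using assms card_1_singletonE by (auto simp: pend_def)
  then show ?thesis
    using that assms nb_subset[of W y] E_irrefl by (auto simp: pend_def nb_def)
qed

lemma nullity_bound:
  assumes "finite W" "conn W" "2 \<le> card W"
  shows "type1 W \<or> int (nullity W) \<le> 2 * cyc_num W + int (card (pend W)) - 1"
  using assms
proof (induction "card W" arbitrary: W rule: less_induct)
  case less
  have hyp: "\<forall>C\<in>comps (W - {x}). 2 \<le> card C \<longrightarrow>
      type1 C \<or> int (nullity C) \<le> 2 * cyc_num C + int (card (pend C)) - 1" if "x \<in> W" for x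
  proof (intro ballI impI)
    fix C assume C: "C \<in> comps (W - {x})" "2 \<le> card C"
    have "C \<subset> W"
      using compsD(1)[OF C(1)] that by blast
    then have "card C < card W" "finite C"
      using less.prems(1) by (auto intro: psubset_card_mono finite_subset)
    then show "type1 C \<or> int (nullity C) \<le> 2 * cyc_num C + int (card (pend C)) - 1"
      using less.hyps C compsD(2) by blast
  qed
  show ?case
  proof (cases "pend W = {}")
    case False
    then obtain y x where y: "y \<in> W" "nb W y = {x}" "x \<in> W"
      using pend_nb by blast
    then show ?thesis
      using leaf_bound(1)[OF less.prems(1,2) y(1,2) hyp[OF y(3)]] by blast
  next
    case True
    show ?thesis
    proof (rule leafless_cases[OF less.prems(1,2) deg_ge_2_if_leafless[OF less.prems True]])
      fix us assume us: "cyc_list W us"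
      show ?thesis
      proof (cases "even (length us) \<and> cyc_gain \<phi> us = (-1) ^ (length us div 2)")
        case True
        then show ?thesis
          using us type1_def by blast
      next
        case False
        then show ?thesis
          using nullity_cyc_list_le_1[OF us refl] cyc_num_cyc_list[OF us refl] by auto
      qed
    next
      fix x w C assume *: "x \<in> W" "C \<in> comps (W - {x})" "w \<in> nb C x" "3 \<le> card (nb W w)" "2 \<le> card (nb C x)"
      show ?thesis
        using leafless_bound(1)[OF less.prems(1,2) True * hyp[OF *(1)]] True by simp
    qed
  qed
qed

section \<open>Finding and removing a Type 1 cycle attached at one vertex\<close>

lemma end_cycle_comp:
  assumes "finite W" "x \<in> W" "C \<in> comps (W - {x})" "type1 C" "card (nb C x) = 1"
  shows "\<exists>a. end_cycle W C a"
proof -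
  obtain a where a: "nb C x = {a}"
    using assms(5) card_1_singletonE by blast
  then have "a \<in> C"
    using nb_subset by blast
  moreover have "card (nb W v) = (if v = a then 3 else 2)" if "v \<in> C" for v
    using card_nb_del[OF assms(1-3) that] type1_facts(4)[OF assms(4) that] a by simp
  ultimately show ?thesis
    using assms(4) compsD(1)[OF assms(3)] unfolding end_cycle_def by auto
qed

lemma end_cycle_deg: "end_cycle W D a \<Longrightarrow> v \<in> D \<Longrightarrow> 2 \<le> card (nb W v)"
  unfolding end_cycle_def by (cases "v = a") auto

lemma end_cycle_pend: "end_cycle W D a \<Longrightarrow> D \<inter> pend W = {}"
  using end_cycle_deg[of W D a] by (fastforce simp: pend_def)

lemma end_cycle_lift:
  assumes "finite W" "x \<in> W" "C \<in> comps (W - {x})" and D: "end_cycle C D a" "nb C x \<inter> D = {}"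
  shows "end_cycle W D a"
proof -
  have "card (nb W v) = card (nb C v)" if "v \<in> D" for v
  proof -
    have "v \<in> C" "v \<notin> nb C x"
      using D that by (auto simp: end_cycle_def)
    then show ?thesis
      using card_nb_del[OF assms(1-3), of v] by simp
  qed
  then show ?thesis
    using D(1) compsD(1)[OF assms(3)] unfolding end_cycle_def by auto
qed

text \<open>Next to a leaf neighbour \<open>x\<close>, some component \<open>C\<close> has a
  positive share of the cyclomatic number, and tightness joins it to \<open>x\<close> by one edge,
  so \<open>C\<close> itself contains a cycle. Either \<open>C\<close> is a Type 1 cycle, or it is
  tight with the neighbour of \<open>x\<close> as a leaf. In the latter case induction applies, and
  the cycle found in \<open>C\<close> contains no leaf of \<open>C\<close>, so \<open>x\<close> is
  not adjacent to it.\<close>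

lemma end_cycle_exists:
  assumes "finite W" "conn W" "tight W" "pend W \<noteq> {}" "1 \<le> cyc_num W"
  shows "\<exists>D a. end_cycle W D a"
  using assms
proof (induction "card W" arbitrary: W rule: less_induct)
  case less
  obtain y x where y: "y \<in> W" "nb W y = {x}" "x \<in> W"
    using less.prems(4) pend_nb by blast
  let ?L = "comps (W - {x}) - {{y}}"
  have hyp: "\<forall>C\<in>comps (W - {x}). 2 \<le> card C \<longrightarrow>
      type1 C \<or> int (nullity C) \<le> 2 * cyc_num C + int (card (pend C)) - 1"
    using nullity_bound compsD(2) comp_finite[OF less.prems(1)] by blast
  note lb = leaf_bound[OF less.prems(1,2) y(1,2) hyp]
  obtain C where C: "C \<in> comps (W - {x})" "C \<noteq> {y}" "1 \<le> cyc_num C + (int (card (nb C x)) - 1)"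
  proof -
    have "\<exists>C\<in>?L. 0 < cyc_num C + (int (card (nb C x)) - 1)"
    proof (rule ccontr)
      assume "\<not> ?thesis"
      then have "cyc_num W \<le> 0"
        unfolding lb(3) by (intro sum_nonpos) (metis not_less)
      then show False
        using less.prems(5) by linarith
    qed
    then show ?thesis
      using that by force
  qed
  have C': "card (nb C x) = 1" "card C = 1 \<or> type1 C \<or> (tight C \<and> nb C x \<subseteq> pend C)"
    using lb(2)[OF less.prems(3) C(1,2)] by blast+
  then have "1 \<le> cyc_num C"
    using C(3) by simp
  then have "card C \<noteq> 1"
    using cyc_num_singleton by (metis card_1_singletonE not_one_le_zero)
  with C'(2) consider "type1 C" | "tight C" "nb C x \<subseteq> pend C"
    by blast
  then show ?case
  proof cases
    case 1
    then show ?thesis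
      using end_cycle_comp[OF less.prems(1) y(3) C(1) _ C'(1)] by blast
  next
    case 2
    have "C \<subset> W"
      using compsD(1)[OF C(1)] y(3) by blast
    then have "card C < card W" "finite C"
      using less.prems(1) by (auto intro: psubset_card_mono finite_subset)
    moreover have "pend C \<noteq> {}"
      using 2(2) C'(1) by auto
    ultimately obtain D a where D: "end_cycle C D a"
      using less.hyps compsD(2)[OF C(1)] 2(1) \<open>1 \<le> cyc_num C\<close> by blast
    then have "nb C x \<inter> D = {}"
      using 2(2) end_cycle_pend by blast
    then show ?thesis
      using end_cycle_lift[OF less.prems(1) y(3) C(1) D] by blast
  qed
qed

lemma end_cycle_remove:
  assumes D: "end_cycle W D a" and fin: "finite W" and con: "conn W"
  defines "W' \<equiv> W - (D - {a})"
  shows "W' \<union> D = W" "D \<inter> W' = {a}" "\<And>u v. u \<in> D - {a} \<Longrightarrow> v \<in> W' - {a} \<Longrightarrow> (u, v) \<notin> E"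
    and "type1 D" "finite W'" "conn W'" "nullity W = nullity W' + 1" "cyc_num W = cyc_num W' + 1"
    and "pend W' = insert a (pend W)" "a \<notin> pend W"
proof -
  show tD: "type1 D" and U: "W' \<union> D = W" and I: "D \<inter> W' = {a}" and finW': "finite W'"
    using D fin by (auto simp: end_cycle_def W'_def)
  show cross: "(u, v) \<notin> E" if u: "u \<in> D - {a}" and v: "v \<in> W' - {a}" for u v
  proof
    assume uv: "(u, v) \<in> E"
    \<comment> \<open>\<open>u\<close> has degree 2 on the cycle and in \<open>W\<close>, so it has
      no neighbour off the cycle.\<close>
    have "nb D u = nb W u"
    proof (rule card_subset_eq)
      show "finite (nb W u)"
        using fin by (rule finite_nb)
      show "nb D u \<subseteq> nb W u"
        using D by (auto simp: end_cycle_def nb_def)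
      show "card (nb D u) = card (nb W u)"
        using type1_facts(4)[OF tD] D u by (auto simp: end_cycle_def)
    qed
    moreover have "v \<in> nb W u"
      using E_sym[OF uv] v by (simp add: nb_def W'_def)
    ultimately show False
      using v by (auto simp: nb_def W'_def)
  qed
  note att = tD I finW' cross
  show "nullity W = nullity W' + 1"
    using nullity_attach[OF att] U by simp
  show "cyc_num W = cyc_num W' + 1"
    using cyc_num_attach[OF att] U by simp
  show "conn W'"
    using conn_attach[OF att] U con by simp
  show "pend W' = insert a (pend W)" "a \<notin> pend W"
    using pend_attach[OF att] U D by (auto simp: end_cycle_def)
qed

lemma end_cycle_tight:
  assumes D: "end_cycle W D a" and fin: "finite W" and con: "conn W" and t: "tight W"
  shows "tight (W - (D - {a}))"
proof -
  have "finite (pend W)"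
    using fin pend_subset finite_subset by blast
  then have "card (pend (W - (D - {a}))) = card (pend W) + 1"
    using end_cycle_remove(9,10)[OF D fin con] by simp
  then show ?thesis
    using end_cycle_remove(7,8)[OF D fin con] t by (simp add: tight_def)
qed

text \<open>If a component other than \<open>C1\<close> contains a cycle, it supplies the end cycle
  as in the case with leaves. Otherwise everything happens in \<open>C1\<close>, where
  \<open>x\<close> is adjacent to the only leaf and to \<open>w\<close>; an end cycle of
  \<open>C1\<close> then survives in \<open>W\<close> only if it avoids \<open>w\<close>.\<close>

lemma end_cycle_exists_leafless:
  assumes fin: "finite W" and con: "conn W" and t: "tight W" and noleaf: "pend W = {}"
    and c: "3 \<le> cyc_num W" and card: "2 \<le> card W"
  shows "\<exists>D a. end_cycle W D a"
proof (rule leafless_cases[OF fin con deg_ge_2_if_leafless[OF fin con card noleaf]])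
  fix us assume "cyc_list W us"
  then show ?thesis
    using cyc_num_cyc_list c by fastforce
next
  fix x w C1 assume x: "x \<in> W" and C1: "C1 \<in> comps (W - {x})" and w: "w \<in> nb C1 x" "3 \<le> card (nb W w)"
    and d: "2 \<le> card (nb C1 x)"
  let ?K = "comps (W - {x})"
  have hyp: "\<forall>C\<in>comps (W - {x}). 2 \<le> card C \<longrightarrow>
      type1 C \<or> int (nullity C) \<le> 2 * cyc_num C + int (card (pend C)) - 1"
    using nullity_bound compsD(2) comp_finite[OF fin] by blast
  note lb = leafless_bound[OF fin con noleaf x C1 w d hyp]
  have C1': "card (nb C1 x) = 2" "type1 C1 \<or> (tight C1 \<and> card (pend C1) = 1 \<and> pend C1 \<subseteq> nb C1 x - {w})"
    using lb(2)[OF t] by blast+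
  show ?thesis
  proof (cases "\<exists>C\<in>?K. C \<noteq> C1 \<and> 1 \<le> cyc_num C")
    case True
    then obtain C where C: "C \<in> ?K" "C \<noteq> C1" "1 \<le> cyc_num C"
      by blast
    have C': "card (nb C x) = 1" "type1 C \<or> (tight C \<and> nb C x \<subseteq> pend C)"
      using lb(3)[OF t C(1,2)] by blast+
    from C'(2) show ?thesis
    proof
      assume "type1 C"
      then show ?thesis
        using end_cycle_comp[OF fin x C(1) _ C'(1)] by blast
    next
      assume T: "tight C \<and> nb C x \<subseteq> pend C"
      then have "pend C \<noteq> {}"
        using C'(1) by auto
      then obtain D a where D: "end_cycle C D a"
        using end_cycle_exists[of C] comp_finite[OF fin C(1)] compsD(2)[OF C(1)] T C(3) by blast
      then have "nb C x \<inter> D = {}"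
        using T end_cycle_pend by blast
      then show ?thesis
        using end_cycle_lift[OF fin x C(1) D] by blast
    qed
  next
    case False
    have "cyc_num W = cyc_num C1 + (int (card (nb C1 x)) - 1) + (\<Sum>C\<in>?K - {C1}. cyc_num C + (int (card (nb C x)) - 1))"
      unfolding cyc_num_del[OF fin x] using C1 fin by (intro sum.remove) (auto simp: finite_comps)
    moreover have "(\<Sum>C\<in>?K - {C1}. cyc_num C + (int (card (nb C x)) - 1)) \<le> 0"
    proof (rule sum_nonpos)
      fix C assume "C \<in> ?K - {C1}"
      then show "cyc_num C + (int (card (nb C x)) - 1) \<le> 0"
        using False lb(3)[OF t, of C] by force
    qed
    \<comment> \<open>The two edges between \<open>x\<close> and \<open>C1\<close> account for one
      unit of the cyclomatic number, so at least two remain inside \<open>C1\<close>. This excludes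
      a Type 1 cycle and provides a second end cycle if the first one contains
      \<open>w\<close>.\<close>
    ultimately have c1: "2 \<le> cyc_num C1"
      using c C1'(1) by simp
    then have "\<not> type1 C1"
      using type1_facts(2)[of C1] by auto
    then have T: "tight C1" "card (pend C1) = 1" "pend C1 \<subseteq> nb C1 x - {w}"
      using C1'(2) by blast+
    have finC: "finite C1" and conC: "conn C1"
      using comp_finite[OF fin C1] compsD(2)[OF C1] .
    have nbx: "nb C1 x = insert w (pend C1)"
    proof -
      have "card (nb C1 x - {w}) = 1"
        using C1'(1) w(1) finC by (simp add: finite_nb)
      then have "pend C1 = nb C1 x - {w}"
        using T(2,3) finC by (intro card_subset_eq) (auto simp: finite_nb)
      then show ?thesis
        using w(1) by blast
    qed
    have "\<exists>D a. end_cycle C1 D a \<and> w \<notin> D"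
    proof -
      have "pend C1 \<noteq> {}"
        using T(2) by auto
      then obtain D a where D: "end_cycle C1 D a"
        using end_cycle_exists[OF finC conC T(1)] c1 by force
      show ?thesis
      proof (cases "w \<in> D")
        case True
        define W' where "W' = C1 - (D - {a})"
        note rem = end_cycle_remove[OF D finC conC, folded W'_def]
        have "tight W'"
          using end_cycle_tight[OF D finC conC T(1)] by (simp add: W'_def)
        then obtain D' a' where D': "end_cycle W' D' a'"
          using end_cycle_exists[OF rem(5,6)] rem(8,9) c1 by force
        \<comment> \<open>\<open>a\<close> is a leaf of \<open>W'\<close>, so the second cycle
          avoids \<open>a\<close> and with it all of \<open>D\<close>, including
          \<open>w\<close>.\<close>
        have aD': "a \<notin> D'"
          using end_cycle_pend[OF D'] rem(9) by blast
        have D'W': "D' \<subseteq> W' - {a}"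
          using D' aD' by (auto simp: end_cycle_def)
        have "nb C1 v = nb W' v" if "v \<in> D'" for v
          using nb_attach_base[OF rem(4,2,5,3), of v] rem(1) D'W' that by auto
        then have "end_cycle C1 D' a'"
          using D' rem(1) unfolding end_cycle_def by auto
        moreover have "w \<notin> D'"
          using True rem(2) D'W' by blast
        ultimately show ?thesis
          by blast
      qed (use D in blast)
    qed
    then obtain D a where D: "end_cycle C1 D a" "w \<notin> D"
      by blast
    have "nb C1 x \<inter> D = {}"
      unfolding nbx using D(2) end_cycle_pend[OF D(1)] by blast
    then show ?thesis
      using end_cycle_lift[OF fin x C1 D(1)] by blast
  qed
qed

subsection \<open>Decomposition into a tree and Type 1 cycles\<close>

text \<open>\<open>X\<close> may be a proper part of the leaves of \<open>T\<close>: during the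
  iteration the other leaves of \<open>T\<close> are exactly the leaves of \<open>W\<close>. The
  last two equations record what is needed to read off p(T) and the rank of the tree.\<close>

definition cycle_decomp :: "'a set \<Rightarrow> 'a set \<Rightarrow> 'a set \<Rightarrow> ('a \<Rightarrow> 'a set) \<Rightarrow> bool" where
  "cycle_decomp W T X D \<longleftrightarrow> conn T \<and> cyc_num T = 0 \<and> X \<subseteq> pend T
    \<and> (\<forall>a\<in>X. type1 (D a) \<and> D a \<inter> T = {a})
    \<and> (\<forall>a\<in>X. \<forall>b\<in>X. a \<noteq> b \<longrightarrow> D a \<inter> D b = {})
    \<and> W = T \<union> (\<Union>a\<in>X. D a)
    \<and> E \<inter> W \<times> W = (E \<inter> T \<times> T) \<union> (\<Union>a\<in>X. E \<inter> D a \<times> D a)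
    \<and> pend W = pend T - X
    \<and> int (card X) = cyc_num W \<and> nullity W = nullity T + card X"

text \<open>The removed cycle leaves its attaching vertex \<open>a\<close> as a leaf of the smaller
  graph, that is, as a leaf of \<open>T\<close> carrying no cycle yet. As the other cycles meet
  \<open>T\<close> only in their own attaching vertices, \<open>D\<close> is disjoint from
  them.\<close>

lemma cycle_decomp_step:
  assumes D: "end_cycle W D a" and fin: "finite W" and con: "conn W"
    and dec: "cycle_decomp (W - (D - {a})) T X F"
  shows "cycle_decomp W T (insert a X) (F(a := D))"
proof -
  define W' where "W' = W - (D - {a})"
  note rem = end_cycle_remove[OF D fin con, folded W'_def]
  have X: "conn T" "cyc_num T = 0" "X \<subseteq> pend T" "\<forall>a\<in>X. type1 (F a) \<and> F a \<inter> T = {a}"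
    "\<forall>a\<in>X. \<forall>b\<in>X. a \<noteq> b \<longrightarrow> F a \<inter> F b = {}" "W' = T \<union> (\<Union>a\<in>X. F a)"
    "E \<inter> W' \<times> W' = (E \<inter> T \<times> T) \<union> (\<Union>a\<in>X. E \<inter> F a \<times> F a)" "pend W' = pend T - X"
    "int (card X) = cyc_num W'" "nullity W' = nullity T + card X"
    using dec unfolding cycle_decomp_def W'_def[symmetric] by - ((elim conjE, assumption)+)
  have a: "a \<in> pend T" "a \<notin> X"
    using rem(9) X(8) by blast+
  then have aT: "a \<in> T"
    using pend_subset by blast
  have FW: "T \<subseteq> W'" "\<And>b. b \<in> X \<Longrightarrow> F b \<subseteq> W'"
    using X(6) by blast+
  have DT: "D \<inter> T = {a}"
    using rem(2) FW(1) aT by blast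
  have DF: "D \<inter> F b = {}" if "b \<in> X" for b
  proof -
    have "D \<inter> F b \<subseteq> {a}"
      using rem(2) FW(2)[OF that] by blast
    moreover have "a \<notin> F b"
    proof
      assume "a \<in> F b"
      moreover have "F b \<inter> T = {b}"
        using X(4) that by blast
      ultimately have "a = b"
        using aT by blast
      then show False
        using that a(2) by simp
    qed
    ultimately show ?thesis
      by blast
  qed
  have upd: "(F(a := D)) b = F b" if "b \<in> X" for b
    using that a(2) by auto
  have UN: "(\<Union>b\<in>X. (F(a := D)) b) = (\<Union>b\<in>X. F b)"
    "(\<Union>b\<in>X. E \<inter> (F(a := D)) b \<times> (F(a := D)) b) = (\<Union>b\<in>X. E \<inter> F b \<times> F b)"
    using upd by auto
  have "E \<inter> W \<times> W = (E \<inter> W' \<times> W') \<union> (E \<inter> D \<times> D)"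
  proof
    show "E \<inter> W \<times> W \<subseteq> (E \<inter> W' \<times> W') \<union> (E \<inter> D \<times> D)"
    proof
      fix p assume "p \<in> E \<inter> W \<times> W"
      then obtain u v where p: "p = (u, v)" "(u, v) \<in> E" "u \<in> W" "v \<in> W"
        by blast
      have "u \<in> W' \<union> D" "v \<in> W' \<union> D"
        using p(3,4) rem(1) by blast+
      moreover have "\<not> (u \<in> D - {a} \<and> v \<in> W' - {a})" "\<not> (v \<in> D - {a} \<and> u \<in> W' - {a})"
        using rem(3) p(2) E_sym[OF p(2)] by blast+
      moreover have "a \<in> D" "a \<in> W'"
        using rem(2) by blast+
      ultimately show "p \<in> (E \<inter> W' \<times> W') \<union> (E \<inter> D \<times> D)"
        using p(1,2) by blast
    qed
    show "(E \<inter> W' \<times> W') \<union> (E \<inter> D \<times> D) \<subseteq> E \<inter> W \<times> W"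
      using rem(1) by blast
  qed
  then have edges: "E \<inter> W \<times> W = (E \<inter> T \<times> T) \<union> (\<Union>b\<in>insert a X. E \<inter> (F(a := D)) b \<times> (F(a := D)) b)"
    unfolding X(7) by (simp only: UN_insert UN(2) fun_upd_same) blast
  have verts: "W = T \<union> (\<Union>b\<in>insert a X. (F(a := D)) b)"
    using rem(1) X(6) by (simp only: UN_insert UN(1) fun_upd_same) blast
  have finX: "finite X"
    using X(3) pend_subset FW(1) rem(5) by (meson finite_subset)
  have pw: "pend W = pend T - insert a X"
    using rem(9,10) X(8) by blast
  have cards: "int (card (insert a X)) = cyc_num W" "nullity W = nullity T + card (insert a X)"
    using X(9,10) rem(7,8) finX a(2) by simp_all
  have t1s: "\<forall>b\<in>insert a X. type1 ((F(a := D)) b) \<and> (F(a := D)) b \<inter> T = {b}"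
    using X(4) rem(4) DT upd by auto
  have disj: "\<forall>b\<in>insert a X. \<forall>c\<in>insert a X. b \<noteq> c \<longrightarrow> (F(a := D)) b \<inter> (F(a := D)) c = {}"
    using X(5) DF upd by (auto simp: Int_commute)
  have "insert a X \<subseteq> pend T"
    using X(3) a(1) by simp
  then show ?thesis
    unfolding cycle_decomp_def by (intro conjI X(1,2) t1s disj verts edges pw cards)
qed

lemma cycle_decomp_exists:
  assumes "finite W" "conn W" "tight W" "pend W \<noteq> {}"
  shows "\<exists>T X D. cycle_decomp W T X D"
  using assms
proof (induction "nat (cyc_num W)" arbitrary: W rule: less_induct)
  case less
  show ?case
  proof (cases "1 \<le> cyc_num W")
    case True
    then obtain D a where D: "end_cycle W D a"
      using end_cycle_exists less.prems by blast
    note rem = end_cycle_remove[OF D less.prems(1,2)]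
    have "nat (cyc_num (W - (D - {a}))) < nat (cyc_num W)"
      using rem(8) True by simp
    then show ?thesis
      using less.hyps[OF _ rem(5,6) end_cycle_tight[OF D less.prems(1-3)]] rem(9)
        cycle_decomp_step[OF D less.prems(1,2)] by blast
  next
    case False
    then have "cyc_num W = 0"
      using cyc_num_nonneg[OF less.prems(1,2)] by linarith
    then have "cycle_decomp W W {} (\<lambda>_. {})"
      using less.prems(2) by (simp add: cycle_decomp_def)
    then show ?thesis
      by blast
  qed
qed

text \<open>A single removal turns the attaching vertex into a leaf, and from then on
  \<open>cycle_decomp_exists\<close> applies.\<close>

lemma cycle_decomp_exists_leafless:
  assumes fin: "finite W" and con: "conn W" and t: "tight W" and noleaf: "pend W = {}" and c: "3 \<le> cyc_num W"
  shows "\<exists>T X D. cycle_decomp W T X D"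
proof -
  have "card W \<noteq> 1"
    using c cyc_num_singleton by (metis card_1_singletonE not_numeral_le_zero)
  moreover have "card W \<noteq> 0"
    using conn_nonempty[OF con] fin by simp
  ultimately have "2 \<le> card W"
    by linarith
  then obtain D a where D: "end_cycle W D a"
    using end_cycle_exists_leafless[OF fin con t noleaf c] by blast
  note rem = end_cycle_remove[OF D fin con]
  show ?thesis
    using cycle_decomp_exists[OF rem(5,6) end_cycle_tight[OF D fin con t]] rem(9)
      cycle_decomp_step[OF D fin con] by blast
qed

text \<open>The cycles are attached one at a time. The condition on \<open>E\<close> says that every
  arc lies in the tree part or in one cycle, so that no arc crosses at any stage.\<close>

lemma nullity_attach_family:
  assumes "finite X" and "finite T"
    and "\<And>x. x \<in> X \<Longrightarrow> type1 (D x)" "\<And>x. x \<in> X \<Longrightarrow> D x \<inter> T = {x}"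
    and "\<And>x y. x \<in> X \<Longrightarrow> y \<in> X \<Longrightarrow> x \<noteq> y \<Longrightarrow> D x \<inter> D y = {}"
    and "E \<subseteq> T \<times> T \<union> (\<Union>x\<in>X. D x \<times> D x)"
  shows "nullity (T \<union> (\<Union>x\<in>X. D x)) = nullity T + card X"
proof -
  have "Y \<subseteq> X \<Longrightarrow> nullity (T \<union> (\<Union>x\<in>Y. D x)) = nullity T + card Y" if "finite Y" for Y
    using that
  proof (induction Y rule: finite_induct)
    case empty
    then show ?case by simp
  next
    case (insert x Y)
    let ?W = "T \<union> (\<Union>y\<in>Y. D y)"
    have x: "x \<in> X"
      using insert.prems by blast
    have disj: "D x \<inter> D y = {}" if "y \<in> X" "y \<noteq> x" for y
      using assms(5)[OF x that(1)] that(2) by blast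
    have DW: "D x \<inter> ?W = {x}"
      using assms(4)[OF x] disj insert by blast
    have "nullity (?W \<union> D x) = nullity ?W + 1"
    proof (rule nullity_attach[OF assms(3)[OF x] DW])
      show "finite ?W"
        using assms(2) insert type1_facts(1) assms(3) by blast
      show "(u, v) \<notin> E" if u: "u \<in> D x - {x}" and v: "v \<in> ?W - {x}" for u v
      proof
        assume "(u, v) \<in> E"
        then consider "u \<in> T" | y where "y \<in> X" "u \<in> D y" "v \<in> D y"
          using assms(6) by blast
        then show False
        proof cases
          case 1
          then show ?thesis
            using u assms(4)[OF x] by blast
        next
          case 2
          then have "y = x"
            using u disj by blast
          then show ?thesis
            using 2 v DW by blast
        qed
      qed
    qed
    moreover have "T \<union> (\<Union>y\<in>insert x Y. D y) = ?W \<union> D x"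
      by blast
    ultimately show ?case
      using insert by simp
  qed
  then show ?thesis
    using assms(1) by blast
qed

section \<open>Translation of degree, connectedness, cyclomatic number and rank for induced
  digraphs\<close>

context
  fixes H :: "'a pair_pre_digraph"
  assumes pg: "pair_graph H" and ind: "parcs H = E \<inter> pverts H \<times> pverts H"
begin

lemma induced_pendants: "pendants H = pend (pverts H)"
proof -
  have "out_degree (with_proj H) v = card (nb (pverts H) v)" if "v \<in> pverts H" for v
  proof -
    have "out_arcs (with_proj H) v = Pair v ` nb (pverts H) v"
      using ind E_sym that by (auto simp: out_arcs_def nb_def image_iff)
    then show ?thesis
      by (simp add: out_degree_def card_image inj_on_def)
  qed
  then show ?thesis
    by (auto simp: pendants_def pend_def)
qed

text \<open>The set of vertices reachable from a given one is closed, and a closed set contains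
  everything reachable from its elements.\<close>

lemma induced_conn: "Digraph_Component.connected (with_proj H) \<longleftrightarrow> conn (pverts H)"
proof -
  interpret H: pair_graph H
    by (rule pg)
  have sym: "(parcs H)\<^sup>s = parcs H"
    by (auto simp: symcl_def intro: H.arcs_symmetric)
  have iff: "Digraph_Component.connected (with_proj H) \<longleftrightarrow>
    pverts H \<noteq> {} \<and> (\<forall>u\<in>pverts H. \<forall>v\<in>pverts H. (u, v) \<in> rtrancl_on (pverts H) (parcs H))"
    by (simp add: connected_conv sym)
  show ?thesis
    unfolding iff
  proof (intro iffI conjI ballI)
    assume L: "pverts H \<noteq> {} \<and> (\<forall>u\<in>pverts H. \<forall>v\<in>pverts H. (u, v) \<in> rtrancl_on (pverts H) (parcs H))"
    show "conn (pverts H)"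
      unfolding conn_def
    proof (intro conjI allI impI)
      fix A assume A: "adj_closed (pverts H) A" "A \<noteq> {}"
      then obtain u where u: "u \<in> A" "u \<in> pverts H"
        by (auto simp: adj_closed_def)
      have "v \<in> A" if "v \<in> pverts H" for v
      proof -
        have "(u, v) \<in> rtrancl_on (pverts H) (parcs H)"
          using L u that by blast
        then show ?thesis
        proof (induction rule: rtrancl_on_induct)
          case base
          then show ?case using u by blast
        next
          case (step y z)
          then show ?case
            using A(1) ind unfolding adj_closed_def by blast
        qed
      qed
      then show "A = pverts H"
        using A(1) by (auto simp: adj_closed_def)
    qed (use L in blast)
  next
    assume R: "conn (pverts H)"
    then show "pverts H \<noteq> {}"
      by (rule conn_nonempty)
    fix u v assume uv: "u \<in> pverts H" "v \<in> pverts H"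
    let ?A = "{w \<in> pverts H. (u, w) \<in> rtrancl_on (pverts H) (parcs H)}"
    have "adj_closed (pverts H) ?A"
      unfolding adj_closed_def using ind by (auto intro: rtrancl_on_into_rtrancl_on)
    moreover have "u \<in> ?A"
      using uv(1) by simp
    ultimately have "?A = pverts H"
      using connD[OF R] by blast
    then show "(u, v) \<in> rtrancl_on (pverts H) (parcs H)"
      using uv(2) by blast
  qed
qed

text \<open>\<open>cyclomatic\<close> counts strong components; a connected symmetric digraph is
  strongly connected and has just one.\<close>

lemma induced_cyclomatic:
  assumes "conn (pverts H)"
  shows "cyclomatic H = cyc_num (pverts H)"
proof -
  interpret H: pair_graph H
    by (rule pg)
  have "strongly_connected (with_proj H)"
    using H.symmetric_connected_imp_strongly_connected[OF H.sym_arcs] induced_conn assms by blast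
  then have "H.sccs = {with_proj H}"
    using H.strongly_connected_eq_iff by blast
  moreover have "edges H = eds (pverts H)"
    using ind by (auto simp: edges_def eds_def)
  ultimately show ?thesis
    by (simp add: cyclomatic_def cyc_num_def)
qed

text \<open>The tree brings its own gain function \<open>\<psi>\<close>, which agrees with
  \<open>\<phi>\<close> only on its arcs.\<close>

lemma induced_gain_rank:
  assumes "\<And>u v. (u, v) \<in> parcs H \<Longrightarrow> \<phi> u v = \<psi> u v"
  shows "int (gain_rank H \<psi>) = int (card (pverts H)) - int (nullity (pverts H))"
proof -
  interpret H: pair_graph H
    by (rule pg)
  have "gain_rank H \<psi> = card (pverts H) - nullity (pverts H)"
    unfolding gain_rank_def
  proof (rule row_left_rank_eq)
    show "finite (pverts H)"
      by (rule H.pair_finite_verts)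
    show "adj_matrix H \<psi> u v = (if (u, v) \<in> E then \<phi> u v else 0)" if "u \<in> pverts H" "v \<in> pverts H" for u v
      using that ind assms[of u v] by (simp add: adj_matrix_def)
  qed
  then show ?thesis
    using nullity_le_card[of "pverts H"] by simp
qed

lemma induced_cycle_in: "cycle_in H us \<Longrightarrow> cyc_in (pverts H) us"
proof -
  assume us: "cycle_in H us"
  have "v \<in> pverts H" if v: "v \<in> set us" for v
  proof -
    obtain k where k: "k < length us" "v = us ! k"
      using v by (metis in_set_conv_nth)
    have "(v, us ! (Suc k mod length us)) \<in> set (cyc_pairs us)"
      unfolding set_cyc_pairs k(2) by (rule image_eqI[where x = k]) (simp_all add: k(1))
    then have "(v, us ! (Suc k mod length us)) \<in> parcs H"
      using us unfolding cycle_in_def by (meson subsetD)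
    then show ?thesis
      unfolding ind by simp
  qed
  then have "set us \<subseteq> pverts H"
    by (rule subsetI)
  moreover have "set (cyc_pairs us) \<subseteq> E"
    using us unfolding cycle_in_def ind by simp
  ultimately show "cyc_in (pverts H) us"
    using us unfolding cycle_in_def cyc_in_def by blast
qed

end

end

section \<open>Gain graphs as instances of the set-based setting, and the characterization of
  equality\<close>

lemma gained_if_gain_graph:
  assumes "gain_graph G \<phi>"
  shows "gained (parcs G) \<phi>"
proof -
  interpret gain_graph G \<phi>
    by (rule assms)
  show ?thesis
  proof
    show "(v, u) \<in> parcs G" if "(u, v) \<in> parcs G" for u v
      using arcs_symmetric that .
    show "(u, u) \<notin> parcs G" for u
      using no_loops' by blast
    show "\<phi> u v * \<phi> v u = 1" if uv: "(u, v) \<in> parcs G" for u v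
    proof -
      have "\<phi> v u \<noteq> 0"
        using gain_unit[OF arcs_symmetric[OF uv]] by (auto simp: qnorm_def zero_quat_def)
      then show ?thesis
        using gain_inverse[OF uv] by simp
    qed
  qed
qed

definition induced :: "'a pair_pre_digraph \<Rightarrow> 'a set \<Rightarrow> 'a pair_pre_digraph" where
  "induced G W = \<lparr>pverts = W, parcs = parcs G \<inter> W \<times> W\<rparr>"

lemma induced_simps [simp]: "pverts (induced G W) = W" "parcs (induced G W) = parcs G \<inter> W \<times> W"
  by (simp_all add: induced_def)

lemma gain_graph_induced:
  assumes "gain_graph G \<phi>" "W \<subseteq> pverts G"
  shows "gain_graph (induced G W) \<phi>"
proof -
  interpret gain_graph G \<phi>
    by (rule assms)
  have "finite W"
    using assms(2) pair_finite_verts finite_subset by blast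
  moreover have "symmetric (with_proj (induced G W))"
    using arcs_symmetric by (auto simp: symmetric_def intro!: symI)
  ultimately show ?thesis
    using no_loops' gain_unit gain_inverse by unfold_locales auto
qed

theorem theorem5p11:
  fixes G :: "'a pair_pre_digraph" and \<phi> :: "'a \<Rightarrow> 'a \<Rightarrow> quat" and n :: nat
  assumes "gain_graph G \<phi>"
    and "Digraph_Component.connected (with_proj G)"
    and "card (pverts G) = n"
    and "card (pendants G) = 0"
    and "cyclomatic G \<ge> 3"
  shows "int (gain_rank G \<phi>) = int n - 2 * cyclomatic G + 1 \<longleftrightarrow>
    (\<exists>(T :: 'a pair_pre_digraph) \<psi>.
       gain_tree T \<psi> \<and>
       int (card (pendants T)) = cyclomatic G \<and>
       int (gain_rank T \<psi>) = int (card (pverts T)) - int (card (pendants T)) + 1 \<and>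
       attach_type1_cycles T \<psi> G \<phi>)"
proof -
  interpret G: gain_graph G \<phi>
    by (rule assms(1))
  interpret g: gained "parcs G" \<phi>
    by (rule gained_if_gain_graph) (rule assms(1))
  let ?V = "pverts G" and ?E = "parcs G"
  have pgG: "pair_graph G"
    by (rule G.pair_graph)
  have indG: "?E = ?E \<inter> ?V \<times> ?V"
    using G.in_arcsD1 G.in_arcsD2 by auto
  note fin = G.pair_finite_verts
  have con: "g.conn ?V"
    using g.induced_conn[OF pgG indG] assms(2) by blast
  have cycG: "cyclomatic G = g.cyc_num ?V"
    using g.induced_cyclomatic[OF pgG indG con] .
  have rankG: "int (gain_rank G \<phi>) = int n - int (g.nullity ?V)"
    using g.induced_gain_rank[OF pgG indG] assms(3) by simp
  have noleaf: "g.pend ?V = {}"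
    using assms(4) fin g.induced_pendants[OF pgG indG] g.pend_subset finite_subset
    by (metis card_0_eq)
  show ?thesis
  proof
    assume "int (gain_rank G \<phi>) = int n - 2 * cyclomatic G + 1"
    then have "g.tight ?V"
      using rankG cycG noleaf by (simp add: g.tight_def)
    then obtain T X D where dec: "g.cycle_decomp ?V T X D"
      using g.cycle_decomp_exists_leafless[OF fin con _ noleaf] assms(5) cycG by auto
    have X: "g.conn T" "g.cyc_num T = 0" "\<forall>a\<in>X. g.type1 (D a) \<and> D a \<inter> T = {a}"
      "\<forall>a\<in>X. \<forall>b\<in>X. a \<noteq> b \<longrightarrow> D a \<inter> D b = {}" "?V = T \<union> (\<Union>a\<in>X. D a)"
      "?E \<inter> ?V \<times> ?V = (?E \<inter> T \<times> T) \<union> (\<Union>a\<in>X. ?E \<inter> D a \<times> D a)" "X \<subseteq> g.pend T"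
      "int (card X) = g.cyc_num ?V" "g.nullity ?V = g.nullity T + card X" "g.pend ?V = g.pend T - X"
      using dec unfolding g.cycle_decomp_def by - ((elim conjE, assumption)+)
    \<comment> \<open>A leaf of \<open>T\<close> outside \<open>X\<close> would be a leaf of
      \<open>G\<close>.\<close>
    have pendT: "g.pend T = X"
      using X(7,10) noleaf by blast
    have sub: "T \<subseteq> ?V" "\<And>a. a \<in> X \<Longrightarrow> D a \<subseteq> ?V"
      using X(5) by blast+
    let ?T = "induced G T"
    have gT: "gain_graph ?T \<phi>"
      using gain_graph_induced[OF assms(1) sub(1)] .
    then have pgT: "pair_graph ?T"
      by (simp add: gain_graph_def)
    have indT: "parcs ?T = ?E \<inter> pverts ?T \<times> pverts ?T"
      by simp
    have "finite T"
      using sub(1) fin finite_subset by blast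
    then have "is_tree ?T"
      unfolding is_tree_def
      using pgT g.induced_conn[OF pgT indT] X(1) g.no_cyc_in_if_cyc_num_zero[OF _ X(1,2)]
        g.induced_cycle_in[OF pgT indT] by auto
    moreover have pT: "pendants ?T = X"
      using g.induced_pendants[OF pgT indT] pendT by simp
    moreover have "int (gain_rank ?T \<phi>) = int (card (pverts ?T)) - int (card (pendants ?T)) + 1"
    proof -
      have "int (g.nullity ?V) = 2 * g.cyc_num ?V - 1"
        using \<open>g.tight ?V\<close> noleaf by (simp add: g.tight_def)
      \<comment> \<open>The nullity of \<open>G\<close> is 2c - 1, and the c attached cycles account
        for c of it.\<close>
      then have "int (g.nullity T) = int (card X) - 1"
        using X(8,9) by linarith
      then show ?thesis
        using g.induced_gain_rank[OF pgT indT, of \<phi>] pT by simp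
    qed
    moreover have "attach_type1_cycles ?T \<phi> G \<phi>"
      unfolding attach_type1_cycles_def
    proof (intro exI[of _ "\<lambda>x. induced G (D x)"] exI[of _ "\<lambda>_. \<phi>"] conjI)
      show "\<forall>x\<in>pendants ?T. type1_cycle (induced G (D x)) \<phi> \<and> pverts (induced G (D x)) \<inter> pverts ?T = {x}"
      proof (intro ballI conjI)
        fix x assume "x \<in> pendants ?T"
        then have x: "x \<in> X"
          using pT by simp
        then show "pverts (induced G (D x)) \<inter> pverts ?T = {x}"
          using X(3) by simp
        obtain us where us: "g.cyc_list (D x) us" "even (length us)" "cyc_gain \<phi> us = (-1) ^ (length us div 2)"
          using X(3) x g.type1_def by blast
        then show "type1_cycle (induced G (D x)) \<phi>"
          unfolding type1_cycle_def
          using gain_graph_induced[OF assms(1) sub(2)[OF x]]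
          by (auto simp: g.cyc_list_def is_cycle_def cyc_gain_def)
      qed
    qed (use X pT indG in auto)
    ultimately show "\<exists>T \<psi>. gain_tree T \<psi> \<and> int (card (pendants T)) = cyclomatic G \<and>
       int (gain_rank T \<psi>) = int (card (pverts T)) - int (card (pendants T)) + 1 \<and>
       attach_type1_cycles T \<psi> G \<phi>"
      using gT X(8) cycG unfolding gain_tree_def by metis
  next
    assume "\<exists>T \<psi>. gain_tree T \<psi> \<and> int (card (pendants T)) = cyclomatic G \<and>
       int (gain_rank T \<psi>) = int (card (pverts T)) - int (card (pendants T)) + 1 \<and>
       attach_type1_cycles T \<psi> G \<phi>"
    then obtain T \<psi> where T: "gain_tree T \<psi>" "int (card (pendants T)) = cyclomatic G"
      "int (gain_rank T \<psi>) = int (card (pverts T)) - int (card (pendants T)) + 1"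
      "attach_type1_cycles T \<psi> G \<phi>"
      by blast
    let ?X = "pendants T"
    obtain C \<gamma> where C: "\<And>x. x \<in> ?X \<Longrightarrow> type1_cycle (C x) (\<gamma> x)"
      "\<And>x. x \<in> ?X \<Longrightarrow> pverts (C x) \<inter> pverts T = {x}"
      "\<And>x y. x \<in> ?X \<Longrightarrow> y \<in> ?X \<Longrightarrow> x \<noteq> y \<Longrightarrow> pverts (C x) \<inter> pverts (C y) = {}"
      "?V = pverts T \<union> (\<Union>x\<in>?X. pverts (C x))" "?E = parcs T \<union> (\<Union>x\<in>?X. parcs (C x))"
      "\<And>u v. (u, v) \<in> parcs T \<Longrightarrow> \<phi> u v = \<psi> u v"
      "\<And>x u v. x \<in> ?X \<Longrightarrow> (u, v) \<in> parcs (C x) \<Longrightarrow> \<phi> u v = \<gamma> x u v"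
      using T(4) unfolding attach_type1_cycles_def by (elim exE) (auto; blast)
    have gT: "gain_graph T \<psi>"
      using T(1) by (simp add: gain_tree_def)
    interpret T: gain_graph T \<psi>
      by (rule gT)
    have arcsT: "parcs T \<subseteq> pverts T \<times> pverts T"
      using T.in_arcsD1 T.in_arcsD2 by auto
    have arcsC: "parcs (C x) \<subseteq> pverts (C x) \<times> pverts (C x)" if "x \<in> ?X" for x
    proof -
      interpret Cx: gain_graph "C x" "\<gamma> x"
        using C(1)[OF that] by (simp add: type1_cycle_def)
      show ?thesis
        using Cx.in_arcsD1 Cx.in_arcsD2 by auto
    qed
    have loop: "(u, u) \<notin> ?E" for u
      by (rule g.E_irrefl)
    have pgT: "pair_graph T"
      by (rule T.pair_graph)
    have indT: "parcs T = ?E \<inter> pverts T \<times> pverts T"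
    proof
      show "?E \<inter> pverts T \<times> pverts T \<subseteq> parcs T"
      proof
        fix p assume p: "p \<in> ?E \<inter> pverts T \<times> pverts T"
        obtain u v where uv: "p = (u, v)"
          by (cases p)
        show "p \<in> parcs T"
        proof (rule ccontr)
          assume "p \<notin> parcs T"
          then obtain x where x: "x \<in> ?X" "(u, v) \<in> parcs (C x)"
            using p uv C(5) by blast
          \<comment> \<open>Each cycle meets the tree in one vertex, so a cycle arc with both ends
            in the tree would be a loop.\<close>
          then have "u = x" "v = x"
            using arcsC[OF x(1)] C(2)[OF x(1)] p uv by blast+
          then show False
            using loop p uv by blast
        qed
      qed
    qed (use arcsT C(5) in blast)
    have t1C: "g.type1 (pverts (C x))" if x: "x \<in> ?X" for x
    proof -
      obtain us where us: "is_cycle (C x) us" "even (length us)"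
        "prod_list (map (\<lambda>(u, v). \<gamma> x u v) (cyc_pairs us)) = (- 1) ^ (length us div 2)"
        using C(1)[OF x] by (auto simp: type1_cycle_def)
      have "?E \<inter> pverts (C x) \<times> pverts (C x) = parcs (C x)"
      proof
        show "?E \<inter> pverts (C x) \<times> pverts (C x) \<subseteq> parcs (C x)"
        proof
          fix p assume p: "p \<in> ?E \<inter> pverts (C x) \<times> pverts (C x)"
          obtain u v where uv: "p = (u, v)"
            by (cases p)
          consider "(u, v) \<in> parcs T" | y where "y \<in> ?X" "(u, v) \<in> parcs (C y)"
            using p uv C(5) by blast
          then show "p \<in> parcs (C x)"
          proof cases
            case 1
            then have "u = x" "v = x"
              using arcsT C(2)[OF x] p uv by blast+
            then show ?thesis
              using loop p uv by blast
          next
            case 2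
            then have "u \<in> pverts (C y) \<inter> pverts (C x)"
              using arcsC[OF 2(1)] p uv by blast
            then have "y = x"
              using C(3)[OF 2(1) x] by blast
            then show ?thesis
              using 2 uv by blast
          qed
        qed
        show "parcs (C x) \<subseteq> ?E \<inter> pverts (C x) \<times> pverts (C x)"
          using arcsC[OF x] C(5) x by blast
      qed
      then have cl: "g.cyc_list (pverts (C x)) us"
        using us(1) by (simp add: g.cyc_list_def is_cycle_def)
      have gains: "map (\<lambda>(u, v). \<phi> u v) (cyc_pairs us) = map (\<lambda>(u, v). \<gamma> x u v) (cyc_pairs us)"
      proof (rule map_cong[OF refl])
        fix p assume "p \<in> set (cyc_pairs us)"
        then have "p \<in> parcs (C x)"
          using us(1) by (simp add: is_cycle_def)
        then show "(case p of (u, v) \<Rightarrow> \<phi> u v) = (case p of (u, v) \<Rightarrow> \<gamma> x u v)"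
          using C(7)[OF x] by (cases p) simp
      qed
      have "cyc_gain \<phi> us = (-1) ^ (length us div 2)"
        unfolding cyc_gain_def gains by (rule us(3))
      then show ?thesis
        using cl us(2) unfolding g.type1_def by blast
    qed
    have "?X \<subseteq> pverts T"
      by (auto simp: pendants_def)
    then have finX: "finite ?X"
      using T.pair_finite_verts finite_subset by blast
    have "g.nullity (pverts T \<union> (\<Union>x\<in>?X. pverts (C x))) = g.nullity (pverts T) + card ?X"
    proof (rule g.nullity_attach_family[OF finX T.pair_finite_verts])
      show "?E \<subseteq> pverts T \<times> pverts T \<union> (\<Union>x\<in>?X. pverts (C x) \<times> pverts (C x))"
        using C(5) arcsT arcsC by blast
    qed (use t1C C(2,3) in blast)+
    then have "g.nullity ?V = g.nullity (pverts T) + card ?X"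
      using C(4) by simp
    moreover have "int (gain_rank T \<psi>) = int (card (pverts T)) - int (g.nullity (pverts T))"
      using g.induced_gain_rank[OF pgT indT C(6)] .
    \<comment> \<open>The rank condition gives the tree nullity c - 1, and the c cycles raise it to
      2c - 1.\<close>
    ultimately show "int (gain_rank G \<phi>) = int n - 2 * cyclomatic G + 1"
      using T(2,3) rankG by linarith
  qed
qed

end
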